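(* Let $G$ be a Polish group which is not CLI and let $H$ be a CLI Polish group. Then for any Polish $H$-space $Y$, $E(G)\not\le_B E_H^Y$.
   Context: For a Polish group $G$, $E(G)$ is the equivalence relation on $G^\omega$ defined by $x\,E(G)\,y$ iff $(x(n)y(n)^{-1})_n$ converges in $G$. A Polish group is CLI if it admits a compatible complete left-invariant metric. A Polish $H$-space is a Polish space $Y$ with a continuous action of $H$; $E_H^Y$ is its orbit equivalence relation ($y E_H^Y y'$ iff $hy=y'$ for some $h\in H$). $\le_B$ denotes Borel reducibility. *)

theory Defs
  imports "HOL-Analysis.Analysis"
begin

text \<open>
  A Polish group is a type of sort \<open>{topological_group_add, polish_space}\<close>.  The library's class
  \<^class>\<open>group_add\<close> does not assume commutativity; the group operation is merely written
  additively, so that $x y^{-1}$ becomes \<open>x - y\<close>.  The metric carried by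
  \<^class>\<open>polish_space\<close> only witnesses complete metrizability and need not be invariant.
\<close>

definition CLI :: "'g::{topological_group_add, polish_space} itself \<Rightarrow> bool" where
  "CLI (_ :: 'g itself) \<longleftrightarrow>
     (\<exists>d :: 'g \<Rightarrow> 'g \<Rightarrow> real.
        Metric_space UNIV d \<and>
        Metric_space.mtopology UNIV d = euclidean \<and>
        Metric_space.mcomplete UNIV d \<and>
        (\<forall>g x y. d (g + x) (g + y) = d x y))"

definition E_group :: "(nat \<Rightarrow> 'g::{topological_group_add, polish_space}) \<Rightarrow> (nat \<Rightarrow> 'g) \<Rightarrow> bool" where
  "E_group x y \<longleftrightarrow> convergent (\<lambda>n. x n - y n)"

definition continuous_action ::
    "('h::{topological_group_add, polish_space} \<Rightarrow> 'y::polish_space \<Rightarrow> 'y) \<Rightarrow> bool" where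
  "continuous_action act \<longleftrightarrow>
     (\<forall>y. act 0 y = y) \<and>
     (\<forall>g h y. act (g + h) y = act g (act h y)) \<and>
     continuous_on UNIV (\<lambda>(h, y). act h y)"

definition orbit_rel :: "('h \<Rightarrow> 'y \<Rightarrow> 'y) \<Rightarrow> 'y \<Rightarrow> 'y \<Rightarrow> bool" where
  "orbit_rel act y y' \<longleftrightarrow> (\<exists>h. act h y = y')"

definition borel_reducible ::
    "('a::polish_space \<Rightarrow> 'a \<Rightarrow> bool) \<Rightarrow> ('b::polish_space \<Rightarrow> 'b \<Rightarrow> bool) \<Rightarrow> bool"
    (infix \<open>\<le>\<^sub>B\<close> 50) where
  "E \<le>\<^sub>B F \<longleftrightarrow> (\<exists>f \<in> borel \<rightarrow>\<^sub>M borel. \<forall>x y. E x y \<longleftrightarrow> F (f x) (f y))"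

end

theory Submission
  imports Defs "HOL-Probability.Discrete_Topology"
begin

text \<open>
  If \<open>G\<close> is not CLI, it contains a divergent sequence \<open>g\<close> with \<open>g m - g n \<rightarrow> 0\<close>. Suppose \<open>f\<close> is a
  Borel reduction. Call a tail translation the addition of one \<open>w \<in> G\<close> to all coordinates from some
  \<open>m\<close> on; it moves a point within its \<open>E(G)\<close>-class. A Baire category argument shows that near a
  generic point, tail translations by small \<open>w\<close> far out move \<open>f x\<close> only by small elements of \<open>H\<close>.
  Starting from a generic \<open>x\<^sub>0\<close>, successive tail translations by \<open>g k\<^sub>i\<^sub>+\<^sub>1 - g k\<^sub>i\<close>, further and further
  out, give points \<open>x\<^sub>i\<close> with a generic limit \<open>y\<close>, and \<open>f x\<^sub>i = a\<^sub>i \<cdot> f x\<^sub>0\<close> with \<open>a\<^sub>i\<close> right Cauchy.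
  As \<open>H\<close> is CLI, \<open>a\<^sub>i\<close> converges, so \<open>f y\<close> lies in the orbit of \<open>f x\<^sub>0\<close>; but \<open>y\<close> differs from \<open>x\<^sub>0\<close>
  along the divergent sequence \<open>g\<close>.
\<close>

section \<open>Meager sets and the Baire property\<close>

definition meager :: "'a::topological_space set \<Rightarrow> bool" where
  "meager A \<longleftrightarrow> (\<exists>F :: nat \<Rightarrow> 'a set. (\<forall>n. closed (F n) \<and> interior (F n) = {}) \<and> A \<subseteq> (\<Union>n. F n))"

lemma meager_subset: "meager B \<Longrightarrow> A \<subseteq> B \<Longrightarrow> meager A"
  unfolding meager_def by blast

lemma meager_closed: "closed F \<Longrightarrow> interior F = {} \<Longrightarrow> meager F"
  unfolding meager_def by (rule exI[of _ "\<lambda>_. F"]) auto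

lemma meager_empty [simp]: "meager {}"
  by (rule meager_closed) auto

lemma meager_UN:
  assumes "\<And>n::nat. meager (A n)"
  shows "meager (\<Union>n. A n)"
proof -
  obtain F :: "nat \<Rightarrow> nat \<Rightarrow> _" where F: "\<And>n k. closed (F n k) \<and> interior (F n k) = {}"
    "\<And>n. A n \<subseteq> (\<Union>k. F n k)"
    using assms unfolding meager_def by metis
  show ?thesis
    unfolding meager_def
  proof (intro exI[of _ "\<lambda>i. F (fst (prod_decode i)) (snd (prod_decode i))"] conjI allI)
    show "(\<Union>n. A n) \<subseteq> (\<Union>i. F (fst (prod_decode i)) (snd (prod_decode i)))"
    proof
      fix x assume "x \<in> (\<Union>n. A n)"
      then obtain n k where "x \<in> F n k" using F(2) by blast
      then have "x \<in> F (fst (prod_decode (prod_encode (n, k)))) (snd (prod_decode (prod_encode (n, k))))"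
        by simp
      then show "x \<in> (\<Union>i. F (fst (prod_decode i)) (snd (prod_decode i)))" by blast
    qed
  qed (use F(1) in auto)
qed

lemma meager_UNION:
  assumes "countable I" "\<And>i. i \<in> I \<Longrightarrow> meager (A i)"
  shows "meager (\<Union>i\<in>I. A i)"
proof (cases "I = {}")
  case False
  have "meager (\<Union>n. A (from_nat_into I n))"
    by (rule meager_UN) (simp add: assms False from_nat_into)
  moreover have "(\<Union>n. A (from_nat_into I n)) = (\<Union>i\<in>I. A i)"
    using range_from_nat_into[OF False assms(1)] by (metis image_image)
  ultimately show ?thesis by simp
qed auto

lemma meager_Un: "meager A \<Longrightarrow> meager B \<Longrightarrow> meager (A \<union> B)"
  using meager_UNION[of "{A, B}" "\<lambda>X. X"] by auto

text \<open>The Baire category theorem; it rules out covering a nonempty open set by countably many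
  meager sets.\<close>

lemma not_meager_open:
  fixes U :: "'a::complete_space set"
  assumes "open U" "U \<noteq> {}"
  shows "\<not> meager U"
proof
  assume "meager U"
  then obtain F :: "nat \<Rightarrow> 'a set" where F: "\<And>n. closed (F n) \<and> interior (F n) = {}" "U \<subseteq> (\<Union>n. F n)"
    unfolding meager_def by auto
  have "Met_TC.mtopology interior_of \<Union>(range F) = {}"
    by (rule Met_TC.metric_Baire_category_alt) (use F in \<open>auto simp: complete_UNIV\<close>)
  then have "interior (\<Union>n. F n) = {}" by simp
  then show False using assms F(2) interior_maximal by blast
qed

text \<open>Pulling an open subset of the preimage of \<open>F n\<close> back along the inverse
  \<open>k\<close> gives an open subset of \<open>F n\<close>, which must be empty.\<close>

lemma meager_vimage_homeomorphism:
  assumes "continuous_on UNIV h" "continuous_on UNIV k" "\<And>x. h (k x) = x" "\<And>x. k (h x) = x" "meager A"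
  shows "meager (h -` A)"
proof -
  obtain F :: "nat \<Rightarrow> 'b set" where F: "\<And>n. closed (F n) \<and> interior (F n) = {}" "A \<subseteq> (\<Union>n. F n)"
    using assms(5) unfolding meager_def by auto
  have "closed (h -` F n)" for n
    using F(1) assms(1) by (simp add: closed_vimage)
  moreover have "interior (h -` F n) = {}" for n
  proof -
    have "open (k -` interior (h -` F n))"
      using assms(2) by (simp add: open_vimage)
    moreover have "k -` interior (h -` F n) \<subseteq> F n"
      using interior_subset assms(3) by fastforce
    ultimately have "k -` interior (h -` F n) = {}"
      using F(1) interior_maximal by blast
    then show ?thesis using assms(4) by (metis ex_in_conv vimageI)
  qed
  moreover have "h -` A \<subseteq> (\<Union>n. h -` F n)" using F(2) by blast
  ultimately show ?thesis
    unfolding meager_def by (intro exI[of _ "\<lambda>n. h -` F n"]) simp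
qed

text \<open>The interior of a product is the product of the interiors. Exceptional sets of sequences
  can thus be discarded in the product with the Cantor set.\<close>

lemma meager_vimage_fst:
  fixes A :: "'a::topological_space set"
  assumes "meager A"
  shows "meager ((fst :: 'a \<times> 'b::topological_space \<Rightarrow> 'a) -` A)"
proof -
  obtain F :: "nat \<Rightarrow> 'a set" where F: "\<And>n. closed (F n) \<and> interior (F n) = {}" "A \<subseteq> (\<Union>n. F n)"
    using assms unfolding meager_def by auto
  have "interior (fst -` F n :: ('a \<times> 'b) set) = {}" for n
    using F(1)[of n] interior_Times[of "F n" "UNIV :: 'b set"] by (simp add: fst_vimage_eq_Times)
  moreover have "closed (fst -` F n :: ('a \<times> 'b) set)" for n
    using F(1) by (simp add: closed_vimage_fst)
  moreover have "fst -` A \<subseteq> (\<Union>n. fst -` F n)" using F(2) by blast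
  ultimately show ?thesis
    unfolding meager_def by (intro exI[of _ "\<lambda>n. fst -` F n"]) simp
qed

section \<open>The Baire property, envelopes and analytic sets\<close>

definition Baire_property :: "'a::topological_space set \<Rightarrow> bool" where
  "Baire_property A \<longleftrightarrow> (\<exists>U. open U \<and> meager (A - U) \<and> meager (U - A))"

lemma Baire_property_open: "open U \<Longrightarrow> Baire_property U"
  unfolding Baire_property_def by (intro exI[of _ U]) auto

text \<open>An open set differs from its closure only by its nowhere dense frontier, so the
  complement of the closure approximates the complement of \<open>A\<close>.\<close>

lemma Baire_property_Compl:
  assumes "Baire_property A"
  shows "Baire_property (- A)"
proof -
  obtain U where U: "open U" "meager (A - U)" "meager (U - A)"
    using assms unfolding Baire_property_def by auto
  have *: "meager (frontier U)"
    by (rule meager_closed) (use interior_subset in \<open>auto simp: U(1) interior_open frontier_def interior_diff\<close>)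
  show ?thesis
    unfolding Baire_property_def
  proof (intro exI[of _ "- closure U"] conjI)
    show "meager (- A - - closure U)"
      by (rule meager_subset[OF meager_Un[OF U(3) *]]) (auto simp: frontier_def interior_open U(1))
    show "meager (- closure U - - A)"
      by (rule meager_subset[OF U(2)]) (use closure_subset in auto)
  qed auto
qed

lemma Baire_property_UN:
  assumes "\<And>n::nat. Baire_property (A n)"
  shows "Baire_property (\<Union>n. A n)"
proof -
  obtain U where U: "\<And>n. open (U n)" "\<And>n. meager (A n - U n)" "\<And>n. meager (U n - A n)"
    using assms unfolding Baire_property_def by metis
  show ?thesis
    unfolding Baire_property_def
  proof (intro exI[of _ "\<Union>n. U n"] conjI)
    show "meager ((\<Union>n. A n) - (\<Union>n. U n))"
      by (rule meager_subset[OF meager_UN[of "\<lambda>n. A n - U n"]]) (use U in auto)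
    show "meager ((\<Union>n. U n) - (\<Union>n. A n))"
      by (rule meager_subset[OF meager_UN[of "\<lambda>n. U n - A n"]]) (use U in auto)
  qed (use U in auto)
qed

lemma Baire_property_Un:
  assumes "Baire_property A" "Baire_property B"
  shows "Baire_property (A \<union> B)"
proof -
  have "Baire_property (\<Union>n::nat. if n = 0 then A else B)"
    by (rule Baire_property_UN) (use assms in auto)
  moreover have "(\<Union>n::nat. if n = 0 then A else B) = A \<union> B"
    by (auto split: if_splits)
  ultimately show ?thesis by simp
qed

lemma Baire_property_Diff:
  assumes "Baire_property A" "Baire_property B"
  shows "Baire_property (A - B)"
proof -
  have "A - B = - (- A \<union> B)" by auto
  then show ?thesis using assms Baire_property_Un Baire_property_Compl by metis
qed

lemma Baire_property_Int:
  assumes "Baire_property A" "Baire_property B"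
  shows "Baire_property (A \<inter> B)"
proof -
  have "A \<inter> B = A - (- B)" by auto
  then show ?thesis using assms Baire_property_Diff Baire_property_Compl by metis
qed

lemma Baire_property_meager: "meager A \<Longrightarrow> Baire_property A"
  unfolding Baire_property_def by (intro exI[of _ "{}"]) auto

lemma Baire_property_borel:
  assumes "A \<in> sets borel"
  shows "Baire_property A"
proof -
  have "A \<in> sigma_sets UNIV {S. open S}"
    using assms by (simp add: borel_def)
  then show ?thesis
  proof (induction rule: sigma_sets.induct)
    case (Compl a)
    then show ?case using Baire_property_Compl by (simp add: Compl_eq_Diff_UNIV)
  qed (auto intro: Baire_property_open Baire_property_UN)
qed

text \<open>The open set approximating \<open>A\<close> must meet \<open>U\<close>, for otherwise
  \<open>A\<close> would be meager in \<open>U\<close>; the intersection of the two serves as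
  \<open>O'\<close>.\<close>

lemma nonmeager_Baire_property_comeager_in_open:
  assumes "Baire_property A" "\<not> meager (A \<inter> U)" "open U"
  obtains O' where "open O'" "O' \<noteq> {}" "O' \<subseteq> U" "meager (O' - A)"
proof -
  obtain Q where Q: "open Q" "meager (A - Q)" "meager (Q - A)"
    using assms unfolding Baire_property_def by auto
  show thesis
  proof
    show "Q \<inter> U \<noteq> {}"
      using assms(2) meager_subset[OF Q(2), of "A \<inter> U"] by auto
    show "meager (Q \<inter> U - A)"
      by (rule meager_subset[OF Q(3)]) auto
  qed (use Q assms in auto)
qed

text \<open>Each preimage of a basic open set is open up to a meager error, and a countable base
  yields only countably many errors.\<close>

lemma borel_measurable_continuous_off_meager:
  fixes f :: "'a::topological_space \<Rightarrow> 'b::second_countable_topology"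
  assumes "f \<in> borel_measurable borel"
  obtains M where "meager M" "continuous_on (- M) f"
proof -
  obtain B :: "'b set set" where B: "countable B" "topological_basis B"
    using ex_countable_basis by auto
  have "\<forall>b\<in>B. \<exists>U. open U \<and> meager (f -` b - U) \<and> meager (U - f -` b)"
  proof
    fix b assume "b \<in> B"
    then have "f -` b \<in> sets borel"
      using measurable_sets[OF assms, of b] topological_basis_open[OF B(2)] by auto
    then show "\<exists>U. open U \<and> meager (f -` b - U) \<and> meager (U - f -` b)"
      using Baire_property_borel unfolding Baire_property_def by blast
  qed
  then obtain U where U: "\<And>b. b \<in> B \<Longrightarrow> open (U b) \<and> meager (f -` b - U b) \<and> meager (U b - f -` b)"
    by metis
  define M where "M = (\<Union>b\<in>B. (f -` b - U b) \<union> (U b - f -` b))"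
  have "meager M"
    unfolding M_def by (rule meager_UNION[OF B(1)]) (use U meager_Un in blast)
  moreover have "continuous_on (- M) f"
    unfolding continuous_on_topological
  proof (intro ballI allI impI)
    fix x C assume x: "x \<in> - M" and C: "open C" "f x \<in> C"
    obtain b where b: "b \<in> B" "f x \<in> b" "b \<subseteq> C"
      using C B(2) topological_basisE by metis
    then have "x \<in> U b" "\<forall>y\<in>- M. y \<in> U b \<longrightarrow> f y \<in> C"
      using x unfolding M_def by blast+
    then show "\<exists>A. open A \<and> x \<in> A \<and> (\<forall>y\<in>- M. y \<in> A \<longrightarrow> f y \<in> C)"
      using U b(1) by blast
  qed
  ultimately show thesis by (rule that)
qed

text \<open>The envelope adds to \<open>A\<close> the closed set \<open>D\<close> of points near
  which \<open>A\<close> is nowhere locally meager. If \<open>D - C\<close> were nonmeager for some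
  \<open>C\<close> containing \<open>A\<close>, it would be comeager in an open set meeting
  \<open>D\<close>; but \<open>A\<close> is meager in that open set, which keeps it away from
  \<open>D\<close>.\<close>

lemma Baire_property_hull:
  fixes A :: "'a::second_countable_topology set"
  obtains B where "A \<subseteq> B" "Baire_property B"
    "\<And>C. A \<subseteq> C \<Longrightarrow> Baire_property C \<Longrightarrow> meager (B - C)"
proof -
  obtain K :: "'a set set" where K: "countable K" "topological_basis K"
    using ex_countable_basis by auto
  define D where "D = - \<Union>{k\<in>K. meager (A \<inter> k)}"
  have clo: "open (- D)"
    unfolding D_def using K(2) topological_basis_open by fastforce
  have AD: "meager (A - D)"
    by (rule meager_subset[OF meager_UNION[of "{k\<in>K. meager (A \<inter> k)}" "\<lambda>k. A \<inter> k"]])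
       (use K(1) in \<open>auto simp: D_def\<close>)
  have D: "U \<inter> D = {}" if "open U" "meager (A \<inter> U)" for U
  proof -
    have "x \<notin> D" if x: "x \<in> U" for x
    proof -
      obtain k where k: "k \<in> K" "x \<in> k" "k \<subseteq> U"
        using K(2) \<open>open U\<close> x topological_basisE by metis
      then have "meager (A \<inter> k)" using meager_subset[OF \<open>meager (A \<inter> U)\<close>] by blast
      then show ?thesis using k by (auto simp: D_def)
    qed
    then show ?thesis by auto
  qed
  show thesis
  proof (rule that[of "A \<union> D"])
    have "A \<union> D = (A - D) \<union> - (- D)" by auto
    then show "Baire_property (A \<union> D)"
      using Baire_property_Un[OF Baire_property_meager[OF AD] Baire_property_Compl[OF Baire_property_open[OF clo]]]
      by simp
    fix C assume C: "A \<subseteq> C" "Baire_property C"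
    have "Baire_property (D - C)"
      using Baire_property_Diff[OF Baire_property_Compl[OF Baire_property_open[OF clo]] C(2)] by simp
    then obtain U where U: "open U" "meager (D - C - U)" "meager (U - (D - C))"
      unfolding Baire_property_def by auto
    have "meager (A \<inter> U)"
      by (rule meager_subset[OF U(3)]) (use C in auto)
    then have "U \<inter> D = {}" using D U(1) by blast
    then show "meager (A \<union> D - C)"
      using C(1) by (intro meager_subset[OF U(2)]) auto
  qed auto
qed

text \<open>Nikodym's theorem. A Souslin scheme of closed balls refines the hulls of the pieces
  \<open>g -` \<phi> ` P s\<close>; outside the meager set on which some hull is not covered by the hulls of its
  children, a branch through the hulls produces a preimage under \<open>\<phi>\<close>.\<close>

lemma Baire_property_vimage_analytic:
  fixes g :: "'a::second_countable_topology \<Rightarrow> 'z::metric_space"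
    and \<phi> :: "'p::{complete_space, second_countable_topology} \<Rightarrow> 'z"
  assumes g: "g \<in> borel_measurable borel" and S: "closed S" and \<phi>: "continuous_on S \<phi>"
  shows "Baire_property (g -` \<phi> ` S)"
proof -
  obtain D :: "'p set" where D: "countable D" "\<And>U. open U \<Longrightarrow> U \<noteq> {} \<Longrightarrow> \<exists>d\<in>D. d \<in> U"
    using countable_dense_setE by metis
  have "D \<noteq> {}" using D(2)[of UNIV] by auto
  define u where "u = from_nat_into D"
  have u: "\<exists>n. dist p (u n) < e" if "e > 0" for p e
  proof -
    have "\<exists>d\<in>D. d \<in> ball p e" by (rule D(2)) (use that in auto)
    then show ?thesis
      using D(1) \<open>D \<noteq> {}\<close> unfolding u_def by (metis from_nat_into_surj mem_ball)
  qed
  \<comment> \<open>Closed conditions with radii tending to zero: points chosen along a branch form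
    a Cauchy sequence whose limit still meets every condition of the branch.\<close>
  define P where "P s = {p\<in>S. \<forall>i<length s. dist p (u (s ! i)) \<le> (1/2)^i}" for s
  define A where "A s = g -` \<phi> ` P s" for s
  have A_split: "A s \<subseteq> (\<Union>n. A (s @ [n]))" for s
  proof
    fix x assume "x \<in> A s"
    then obtain p where p: "p \<in> P s" "g x = \<phi> p" by (auto simp: A_def)
    obtain n where "dist p (u n) < (1/2)^length s" using u[of "(1/2)^length s"] by auto
    then have "p \<in> P (s @ [n])" using p(1) by (auto simp: P_def nth_append less_Suc_eq)
    then show "x \<in> (\<Union>n. A (s @ [n]))" using p(2) by (auto simp: A_def)
  qed
  obtain h where h: "\<And>s. A s \<subseteq> h s" "\<And>s. Baire_property (h s)"
     "\<And>s C. A s \<subseteq> C \<Longrightarrow> Baire_property C \<Longrightarrow> meager (h s - C)"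
  proof -
    have "\<forall>s. \<exists>B. A s \<subseteq> B \<and> Baire_property B \<and> (\<forall>C. A s \<subseteq> C \<longrightarrow> Baire_property C \<longrightarrow> meager (B - C))"
      using Baire_property_hull by metis
    then show ?thesis using that by metis
  qed
  \<comment> \<open>Intersecting with a Borel set preserves the Baire property, and the closure
    keeps \<open>g x\<close> near the values of \<open>\<phi>\<close> on \<open>P s\<close>.\<close>
  define H where "H s = h s \<inter> g -` closure (\<phi> ` P s)" for s
  have "g -` closure (\<phi> ` P s) \<in> sets borel" for s
    using measurable_sets[OF g, of "closure (\<phi> ` P s)"] by auto
  then have BH: "Baire_property (H s)" for s
    unfolding H_def using h(2) Baire_property_Int Baire_property_borel by blast
  have AH: "A s \<subseteq> H s" for s
    using h(1) closure_subset unfolding H_def A_def by fast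
  define M where "M = (\<Union>s. H s - (\<Union>n. H (s @ [n])))"
  have "meager (H s - (\<Union>n. H (s @ [n])))" for s
  proof -
    have "meager (h s - (\<Union>n. H (s @ [n])))"
    proof (rule h(3))
      show "A s \<subseteq> (\<Union>n. H (s @ [n]))" using A_split[of s] AH by blast
      show "Baire_property (\<Union>n. H (s @ [n]))" using BH by (rule Baire_property_UN)
    qed
    then show ?thesis by (rule meager_subset) (auto simp: H_def)
  qed
  then have M: "meager M"
    unfolding M_def by (intro meager_UNION) auto
  have "H [] - M \<subseteq> A []"
  proof
    fix x assume x: "x \<in> H [] - M"
    have "\<exists>n. x \<in> H (s @ [n])" if "x \<in> H s" for s
      using x that unfolding M_def by blast
    then obtain nx where nx: "\<And>s. x \<in> H s \<Longrightarrow> x \<in> H (s @ [nx s])" by metis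
    \<comment> \<open>The branch starts at the empty string and always moves to a child whose
      \<open>H\<close> still contains \<open>x\<close>; outside \<open>M\<close> there is
      one.\<close>
    define b where "b = rec_nat [] (\<lambda>_ s. s @ [nx s])"
    have b_Suc: "b (Suc k) = b k @ [nx (b k)]" and b0: "b 0 = []" for k by (simp_all add: b_def)
    have bH: "x \<in> H (b k)" for k
    proof (induction k)
      case (Suc k)
      then show ?case unfolding b_Suc by (rule nx)
    qed (use x in \<open>simp add: b0\<close>)
    have len: "length (b k) = k" for k by (induction k) (auto simp: b_Suc b0)
    have b_nth: "b k ! i = nx (b i)" if "i < k" for i k
      using that by (induction k) (auto simp: b_Suc len nth_append less_Suc_eq)
    have Pb: "P (b k) = {p\<in>S. \<forall>i<k. dist p (u (nx (b i))) \<le> (1/2)^i}" for k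
      unfolding P_def len using b_nth by auto
    have "P (b k) \<noteq> {}" for k using bH[of k] by (auto simp: H_def)
    then have "\<forall>k. \<exists>q. q \<in> P (b k)" by blast
    then obtain p where p: "\<And>k. p k \<in> P (b k)" by metis
    have small: "dist q q' \<le> 2 * (1/2)^i" if "q \<in> P (b k)" "q' \<in> P (b l)" "i < k" "i < l" for q q' k l i
    proof -
      have "dist q (u (nx (b i))) \<le> (1/2)^i" "dist q' (u (nx (b i))) \<le> (1/2)^i"
        using that by (auto simp: Pb)
      then show ?thesis using dist_triangle2[of q q' "u (nx (b i))"] by simp
    qed
    have half: "\<exists>i. 2 * (1/2)^i < e" if e: "e > 0" for e :: real
    proof -
      obtain i where "(1/2)^i < e/2" using real_arch_pow_inv[of "e/2" "1/2"] e by auto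
      then show ?thesis by (intro exI[of _ i]) auto
    qed
    have "Cauchy p"
      unfolding Cauchy_def
    proof (intro allI impI)
      fix e :: real assume "e > 0"
      then obtain i where "2 * (1/2)^i < e" using half by blast
      then have "\<forall>m\<ge>Suc i. \<forall>n\<ge>Suc i. dist (p m) (p n) < e"
        using small[OF p p, of i] by (metis Suc_le_lessD le_less_trans)
      then show "\<exists>M. \<forall>m\<ge>M. \<forall>n\<ge>M. dist (p m) (p n) < e" by blast
    qed
    then obtain q where q: "p \<longlonglongrightarrow> q" using Cauchy_convergent_iff convergent_def by blast
    have "q \<in> S"
      using closed_sequentially[OF S _ q] p by (auto simp: P_def)
    have qP: "q \<in> P (b k)" for k
    proof -
      have "dist q (u (nx (b i))) \<le> (1/2)^i" for i
      proof (rule LIMSEQ_le_const2)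
        show "(\<lambda>n. dist (p n) (u (nx (b i)))) \<longlonglongrightarrow> dist q (u (nx (b i)))"
          by (intro tendsto_intros q)
        show "\<exists>N. \<forall>n\<ge>N. dist (p n) (u (nx (b i))) \<le> (1 / 2) ^ i"
          using p Pb by (intro exI[of _ "Suc i"]) auto
      qed
      then show ?thesis using \<open>q \<in> S\<close> by (auto simp: Pb)
    qed
    \<comment> \<open>Continuity at \<open>q\<close> shrinks the images of the
      \<open>P (b k)\<close> to the point \<open>\<phi> q\<close>, while \<open>g x\<close> lies in
      the closure of each of them.\<close>
    have "dist (g x) (\<phi> q) \<le> e" if "e > 0" for e
    proof -
      obtain d where d: "d > 0" "\<And>p. p \<in> S \<Longrightarrow> dist p q < d \<Longrightarrow> dist (\<phi> p) (\<phi> q) < e"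
        using \<phi> \<open>q \<in> S\<close> \<open>e > 0\<close> unfolding continuous_on_iff by blast
      obtain i where i: "2 * (1/2)^i < d" using half d(1) by blast
      have "\<phi> ` P (b (Suc i)) \<subseteq> cball (\<phi> q) e"
      proof
        fix z assume "z \<in> \<phi> ` P (b (Suc i))"
        then obtain r where r: "r \<in> P (b (Suc i))" "z = \<phi> r" by auto
        then have "dist r q < d" using small[OF r(1) qP, of i "Suc i"] i by auto
        then show "z \<in> cball (\<phi> q) e" using d(2)[of r] r by (auto simp: P_def dist_commute)
      qed
      then have "closure (\<phi> ` P (b (Suc i))) \<subseteq> cball (\<phi> q) e"
        by (simp add: closure_minimal)
      then show ?thesis using bH[of "Suc i"] by (auto simp: H_def dist_commute)
    qed
    then have "dist (g x) (\<phi> q) \<le> 0" by (metis field_le_epsilon add_0)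
    then have "g x = \<phi> q" by simp
    then show "x \<in> A []" using qP[of 0] by (auto simp: A_def b0)
  qed
  then have "A [] = H [] - (H [] - A [])" "H [] - A [] \<subseteq> M" using AH by auto
  then have "Baire_property (A [])"
    using Baire_property_Diff[OF BH Baire_property_meager[OF meager_subset[OF M]]] by metis
  then show ?thesis by (simp add: A_def P_def)
qed

section \<open>Left-invariant metrics\<close>

lemma open_triple_sum_nhds:
  fixes U :: "'a::topological_monoid_add set"
  assumes "open U" "0 \<in> U"
  obtains N where "open N" "0 \<in> N" "\<And>a b c. a \<in> N \<Longrightarrow> b \<in> N \<Longrightarrow> c \<in> N \<Longrightarrow> a + b + c \<in> U"
proof -
  have "open ((\<lambda>(a, b, c). a + b + c) -` U)"
    using assms(1) by (rule open_vimage) (auto simp: case_prod_beta intro!: continuous_intros)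
  moreover have "(0, 0, 0) \<in> (\<lambda>(a, b, c). a + b + c) -` U" using assms by simp
  ultimately obtain A B where A: "open A" "0 \<in> A" "open B" "(0, 0) \<in> B"
      "A \<times> B \<subseteq> (\<lambda>(a, b, c). a + b + c) -` U"
    by (rule open_prod_elim) auto
  obtain C D where C: "open C" "0 \<in> C" "open D" "0 \<in> D" "C \<times> D \<subseteq> B"
    using open_prod_elim[OF A(3,4)] by (metis mem_Sigma_iff)
  show thesis
  proof (rule that[of "A \<inter> C \<inter> D"])
    fix a b c assume "a \<in> A \<inter> C \<inter> D" "b \<in> A \<inter> C \<inter> D" "c \<in> A \<inter> C \<inter> D"
    then have "(a, b, c) \<in> A \<times> B" using C by auto
    then show "a + b + c \<in> U" using A(5) by auto
  qed (use A C in auto)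
qed

text \<open>\<open>z\<close> is the entry at which the partial sums first reach \<open>t\<close>.
  With \<open>t\<close> half the total weight, this cuts a list into two light parts and one single
  entry.\<close>

lemma sum_list_split_at:
  fixes w :: "'a \<Rightarrow> real"
  assumes "xs \<noteq> []" "\<And>x. w x \<ge> 0" "0 \<le> t" "t \<le> sum_list (map w xs)"
  shows "\<exists>ys z zs. xs = ys @ z # zs \<and> sum_list (map w ys) \<le> t \<and>
           sum_list (map w zs) \<le> sum_list (map w xs) - t"
  using assms(1,3,4)
proof (induction xs arbitrary: t)
  case (Cons x xs)
  show ?case
  proof (cases "t \<le> w x")
    case True
    then show ?thesis using Cons.prems by (intro exI[of _ "[]"] exI[of _ x] exI[of _ xs]) auto
  next
    case False
    then have "xs \<noteq> []" using Cons.prems by auto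
    then obtain ys z zs where "xs = ys @ z # zs" "sum_list (map w ys) \<le> t - w x"
        "sum_list (map w zs) \<le> sum_list (map w xs) - (t - w x)"
      using Cons.IH[of "t - w x"] Cons.prems(3) False by (metis diff_ge_0_iff_ge diff_le_eq add.commute linear list.simps(9) sum_list.Cons)
    then show ?thesis by (intro exI[of _ "x # ys"] exI[of _ z] exI[of _ zs]) auto
  qed
qed simp

text \<open>Birkhoff and Kakutani: the distance from \<open>0\<close> to \<open>g\<close> is the infimum of \<open>\<Sum> 2\<^sup>-\<^sup>n\<^sup>i\<close> over all
  representations of \<open>g\<close> as a sum of elements of \<open>V n\<^sub>i\<close>, where \<open>V\<close> is a basis at \<open>0\<close> with
  \<open>V (n+1) + V (n+1) + V (n+1) \<subseteq> V n\<close>.\<close>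

lemma left_invariant_metric_exists:
  obtains d :: "'g::{topological_group_add, metric_space} \<Rightarrow> 'g \<Rightarrow> real"
  where "Metric_space UNIV d" "Metric_space.mtopology UNIV d = euclidean"
    "\<And>g x y. d (g + x) (g + y) = d x y"
proof -
  \<comment> \<open>Taking \<open>V 0\<close> to be the whole group gives every element a
    representation; the balls make \<open>V\<close> shrink to \<open>0\<close>, which later yields
    separation and the right topology.\<close>
  have "\<exists>V :: nat \<Rightarrow> 'g set. \<forall>n. (open (V n) \<and> 0 \<in> V n \<and> uminus ` V n \<subseteq> V n \<and>
      (if n = 0 then V n = UNIV else V n \<subseteq> ball 0 ((1/2)^n))) \<and>
      (\<forall>a\<in>V (Suc n). \<forall>b\<in>V (Suc n). \<forall>c\<in>V (Suc n). a + b + c \<in> V n)"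
  proof (rule dependent_nat_choice)
    fix V :: "'g set" and n :: nat
    assume V: "open V \<and> 0 \<in> V \<and> uminus ` V \<subseteq> V \<and>
      (if n = 0 then V = UNIV else V \<subseteq> ball 0 ((1/2)^n))"
    then obtain N where N: "open N" "0 \<in> N" "\<And>a b c. a \<in> N \<Longrightarrow> b \<in> N \<Longrightarrow> c \<in> N \<Longrightarrow> a + b + c \<in> V"
      using open_triple_sum_nhds by metis
    define N' where "N' = N \<inter> ball 0 ((1/2)^Suc n)"
    have N': "open N'" "0 \<in> N'" using N by (auto simp: N'_def)
    have "open (uminus -` N')"
      using N'(1) by (rule open_vimage) (auto intro: continuous_intros)
    then show "\<exists>V'. (open V' \<and> 0 \<in> V' \<and> uminus ` V' \<subseteq> V' \<and>
      (if Suc n = 0 then V' = UNIV else V' \<subseteq> ball 0 ((1/2)^Suc n))) \<and>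
      (\<forall>a\<in>V'. \<forall>b\<in>V'. \<forall>c\<in>V'. a + b + c \<in> V)"
      using N N' by (intro exI[of _ "N' \<inter> uminus -` N'"]) (auto simp: N'_def)
  qed (auto intro!: exI[of _ UNIV])
  then obtain V :: "nat \<Rightarrow> 'g set" where V: "\<And>n. open (V n)" "\<And>n. 0 \<in> V n"
      "\<And>n. uminus ` V n \<subseteq> V n" "V 0 = UNIV" "\<And>n. n > 0 \<Longrightarrow> V n \<subseteq> ball 0 ((1/2)^n)"
      "\<And>n a b c. a \<in> V (Suc n) \<Longrightarrow> b \<in> V (Suc n) \<Longrightarrow> c \<in> V (Suc n) \<Longrightarrow> a + b + c \<in> V n"
    by (metis gr_implies_not0)
  have V_Suc: "V (Suc n) \<subseteq> V n" for n
    using V(6)[of _ n 0 0] V(2) by auto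
  have V_mono: "V n \<subseteq> V m" if "m \<le> n" for m n
    using that by (induction rule: dec_induct) (use V_Suc in auto)
  define wt where "wt xs = sum_list (map (\<lambda>p. (1/2)^fst p :: real) xs)" for xs :: "(nat \<times> 'g) list"
  define vl where "vl xs = sum_list (map snd xs)" for xs :: "(nat \<times> 'g) list"
  define ok where "ok xs \<longleftrightarrow> (\<forall>p\<in>set xs. snd p \<in> V (fst p))" for xs :: "(nat \<times> 'g) list"
  have wt_nonneg: "wt xs \<ge> 0" for xs unfolding wt_def by (rule sum_list_nonneg) auto
  have wt_append: "wt (xs @ ys) = wt xs + wt ys" and vl_append: "vl (xs @ ys) = vl xs + vl ys"
    and ok_append: "ok (xs @ ys) \<longleftrightarrow> ok xs \<and> ok ys" for xs ys by (auto simp: wt_def vl_def ok_def)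
  have wt_Cons: "wt (p # xs) = (1/2)^fst p + wt xs" and vl_Cons: "vl (p # xs) = snd p + vl xs"
    and ok_Cons: "ok (p # xs) \<longleftrightarrow> snd p \<in> V (fst p) \<and> ok xs" for p xs by (auto simp: wt_def vl_def ok_def)
  \<comment> \<open>Splitting at half the weight puts both outer sums into \<open>V (Suc m)\<close>
    by induction. The middle entry alone weighs less than \<open>(1/2)^m\<close>, so its index is at
    least \<open>Suc m\<close>, and the triple sum lands in \<open>V m\<close>.\<close>
  have chain: "vl xs \<in> V m" if "ok xs" "wt xs < (1/2)^m" for xs m
    using that
  proof (induction "length xs" arbitrary: xs m rule: less_induct)
    case less
    show ?case
    proof (cases "xs = []")
      case False
      then obtain ys z zs where s: "xs = ys @ z # zs" "wt ys \<le> wt xs / 2" "wt zs \<le> wt xs / 2"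
      proof -
        have "wt xs - wt xs / 2 = wt xs / 2" by simp
        then show ?thesis
          using sum_list_split_at[of xs "\<lambda>p. (1/2)^fst p" "wt xs / 2"] wt_nonneg[of xs] False that
          unfolding wt_def[symmetric] by fastforce
      qed
      have half: "wt xs / 2 < (1/2)^Suc m" using less.prems(2) by simp
      have okz: "ok ys" "ok zs" "snd z \<in> V (fst z)"
        using less.prems(1) s(1) by (auto simp: ok_append ok_Cons)
      have "vl ys \<in> V (Suc m)" by (rule less.hyps) (use s okz half in auto)
      moreover have "vl zs \<in> V (Suc m)" by (rule less.hyps) (use s okz half in auto)
      moreover have "snd z \<in> V (Suc m)"
      proof -
        have "(1/2)^fst z < (1/2 :: real)^m"
          using less.prems(2) wt_nonneg[of ys] wt_nonneg[of zs] unfolding s(1) wt_append wt_Cons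
          by linarith
        then have "Suc m \<le> fst z"
          by (simp add: power_strict_decreasing_iff Suc_le_eq)
        then show ?thesis using okz V_mono by blast
      qed
      ultimately show ?thesis using V(6) s(1) by (simp add: vl_append vl_Cons add.assoc)
    qed (simp add: vl_def V(2))
  qed
  define N where "N g = Inf {wt xs | xs. ok xs \<and> vl xs = g}" for g
  have bdd: "bdd_below {wt xs | xs. ok xs \<and> vl xs = g}" for g
    using wt_nonneg by (auto intro!: bdd_belowI[of _ 0])
  have ne: "{wt xs | xs. ok xs \<and> vl xs = g} \<noteq> {}" for g
    by (auto simp: ok_def vl_def V(4) intro!: exI[of _ "[(0, g)]"])
  have N_le: "N (vl xs) \<le> wt xs" if "ok xs" for xs
    unfolding N_def by (rule cInf_lower[OF _ bdd]) (use that in auto)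
  have N_nonneg: "N g \<ge> 0" for g
    unfolding N_def by (rule cInf_greatest[OF ne]) (use wt_nonneg in auto)
  have N_less: "\<exists>xs. ok xs \<and> vl xs = g \<and> wt xs < r" if "N g < r" for g r
    using cInf_lessD[OF ne that[unfolded N_def]] by auto
  have N_V: "g \<in> V m" if "N g < (1/2)^m" for g m
    using N_less[OF that] chain by auto
  have V_N: "N g \<le> (1/2)^m" if "g \<in> V m" for g m
    using N_le[of "[(m, g)]"] that by (simp add: ok_def vl_def wt_def)
  have N_0: "N 0 = 0"
    using N_le[of "[]"] N_nonneg[of 0] by (simp add: ok_def vl_def wt_def)
  have N_add: "N (a + b) \<le> N a + N b" for a b
  proof (rule field_le_epsilon)
    fix e :: real assume "e > 0"
    then obtain xs ys where "ok xs" "vl xs = a" "wt xs < N a + e/2" "ok ys" "vl ys = b" "wt ys < N b + e/2"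
      using N_less[of a "N a + e/2"] N_less[of b "N b + e/2"] by auto
    then show "N (a + b) \<le> N a + N b + e"
      using N_le[of "xs @ ys"] by (auto simp: ok_append vl_append wt_append)
  qed
  \<comment> \<open>Negating a noncommutative sum reverses the order of its terms; the symmetry of
    each \<open>V n\<close> keeps the entries admissible.\<close>
  have neg: "ok (rev (map (\<lambda>p. (fst p, - snd p)) xs))"
    "vl (rev (map (\<lambda>p. (fst p, - snd p)) xs)) = - vl xs"
    "wt (rev (map (\<lambda>p. (fst p, - snd p)) xs)) = wt xs" if "ok xs" for xs
  proof -
    show "ok (rev (map (\<lambda>p. (fst p, - snd p)) xs))" using that V(3) by (auto simp: ok_def)
    show "vl (rev (map (\<lambda>p. (fst p, - snd p)) xs)) = - vl xs"
      by (induction xs) (auto simp: vl_def minus_add)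
    show "wt (rev (map (\<lambda>p. (fst p, - snd p)) xs)) = wt xs"
      by (induction xs) (auto simp: wt_def)
  qed
  have N_minus_le: "N (- g) \<le> N g" for g
  proof (rule field_le_epsilon)
    fix e :: real assume "e > 0"
    then obtain xs where "ok xs" "vl xs = g" "wt xs < N g + e"
      using N_less[of g "N g + e"] by auto
    then show "N (- g) \<le> N g + e" using N_le[OF neg(1)[of xs]] neg(2,3)[of xs] by simp
  qed
  have N_minus: "N (- g) = N g" for g
    using N_minus_le[of g] N_minus_le[of "- g"] by simp
  have half: "\<exists>m>0. (1/2)^m < e" if e: "e > 0" for e :: real
  proof -
    obtain m where "(1/2)^m < e" using real_arch_pow_inv[of e "1/2"] e by auto
    then have "(1/2)^Suc m < e"
      using power_decreasing[of m "Suc m" "1/2::real"] by linarith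
    then show ?thesis by blast
  qed
  have small: "\<exists>m. V m \<subseteq> ball 0 e" if "e > 0" for e
  proof -
    obtain m where "m > 0" "(1/2)^m < e" using half \<open>e > 0\<close> by blast
    then show ?thesis using V(5)[of m] by (intro exI[of _ m]) auto
  qed
  have N_eq_0: "g = 0" if "N g = 0" for g
  proof -
    have "dist 0 g < e" if "e > 0" for e
      using small[OF that] N_V[of g] \<open>N g = 0\<close> by fastforce
    then show ?thesis by (metis less_irrefl zero_less_dist_iff)
  qed
  define d where "d x y = N (- x + y)" for x y
  interpret Metric_space UNIV d
  proof
    show "d x y = d y x" for x y
      using N_minus[of "- x + y"] by (simp add: d_def minus_add)
    show "(d x y = 0) = (x = y)" for x y
      using N_eq_0[of "- x + y"] N_0 by (auto simp: d_def neg_eq_iff_add_eq_0[symmetric])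
    show "d x z \<le> d x y + d y z" for x y z
      using N_add[of "- x + y" "- y + z"] by (simp add: d_def add.assoc[symmetric])
  qed (use N_nonneg in \<open>auto simp: d_def\<close>)
  have "openin mtopology U \<longleftrightarrow> open U" for U
  proof
    assume U: "openin mtopology U"
    show "open U"
    proof (subst open_subopen, intro ballI)
      fix x assume "x \<in> U"
      then obtain r where r: "r > 0" "mball x r \<subseteq> U" using U by (auto simp: openin_mtopology)
      obtain m where m: "(1/2)^m < r" using half[OF r(1)] by auto
      have "open ((\<lambda>y. - x + y) -` V m)"
        using V(1) by (rule open_vimage) (auto intro: continuous_intros)
      moreover have "(\<lambda>y. - x + y) -` V m \<subseteq> U"
        using r(2) V_N[of _ m] m by (fastforce simp: in_mball d_def)
      ultimately show "\<exists>T. open T \<and> x \<in> T \<and> T \<subseteq> U"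
        using V(2) by (intro exI[of _ "(\<lambda>y. - x + y) -` V m"]) auto
    qed
  next
    assume U: "open U"
    show "openin mtopology U"
      unfolding openin_mtopology
    proof (intro conjI allI impI)
      fix x assume "x \<in> U"
      have "open ((+) x -` U)"
        using U by (rule open_vimage) (auto intro: continuous_intros)
      then obtain e where e: "e > 0" "ball 0 e \<subseteq> (+) x -` U"
        using \<open>x \<in> U\<close> unfolding open_contains_ball by force
      obtain m where m: "V m \<subseteq> ball 0 e" using small e(1) by blast
      have "y \<in> U" if "y \<in> mball x ((1/2)^m)" for y
      proof -
        have "- x + y \<in> V m" using that by (intro N_V) (auto simp: d_def)
        then have "x + (- x + y) \<in> U" using m e(2) by blast
        then show ?thesis by (simp add: add.assoc[symmetric])
      qed
      then show "\<exists>r>0. mball x r \<subseteq> U" by (intro exI[of _ "(1/2)^m"]) auto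
    qed auto
  qed
  then have "mtopology = euclidean" by (simp add: topology_eq)
  moreover have "d (g + x) (g + y) = d x y" for g x y
    by (simp add: d_def minus_add add.assoc) (simp add: add.assoc[symmetric])
  ultimately show thesis using that Metric_space_axioms by blast
qed

text \<open>A compatible left-invariant metric always exists, so here it must be incomplete. The
  inverses of a Cauchy sequence without limit work, because left invariance measures
  \<open>- u m + u n\<close>.\<close>

lemma not_CLI_right_Cauchy_divergent:
  assumes "\<not> CLI TYPE('g::{topological_group_add, polish_space})"
  obtains g :: "nat \<Rightarrow> 'g::{topological_group_add, polish_space}" where "\<not> convergent g"
    "\<And>V. open V \<Longrightarrow> 0 \<in> V \<Longrightarrow> \<exists>k. \<forall>m\<ge>k. \<forall>n\<ge>k. g m - g n \<in> V"
proof -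
  obtain d :: "'g \<Rightarrow> 'g \<Rightarrow> real"
    where d: "Metric_space UNIV d" "Metric_space.mtopology UNIV d = euclidean"
    "\<And>g x y. d (g + x) (g + y) = d x y"
    using left_invariant_metric_exists by metis
  interpret Metric_space UNIV d by fact
  have "\<not> mcomplete" using assms d unfolding CLI_def by blast
  then obtain u where u: "MCauchy u" "\<And>x. \<not> limitin mtopology u x sequentially"
    unfolding mcomplete_def by blast
  show thesis
  proof
    show "\<not> convergent (\<lambda>n. - u n)"
    proof
      assume "convergent (\<lambda>n. - u n)"
      then obtain l where "(\<lambda>n. - u n) \<longlonglongrightarrow> l" by (auto simp: convergent_def)
      then have "u \<longlonglongrightarrow> - l" using tendsto_minus by fastforce
      then show False using u(2) by (simp add: d(2))
    qed
    fix V :: "'g set" assume "open V" "0 \<in> V"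
    then have "openin mtopology V" by (simp add: d(2))
    then obtain r where r: "r > 0" "mball 0 r \<subseteq> V" using \<open>0 \<in> V\<close> by (auto simp: openin_mtopology)
    obtain k where k: "\<And>m n. m \<ge> k \<Longrightarrow> n \<ge> k \<Longrightarrow> d (u m) (u n) < r"
      using u(1) r(1) unfolding MCauchy_def by blast
    have "- u m - - u n \<in> V" if "m \<ge> k" "n \<ge> k" for m n
    proof -
      have "d 0 (- u m + u n) = d (u m) (u n)"
        using d(3)[of "u m" 0 "- u m + u n"] by (simp add: add.assoc[symmetric])
      then show ?thesis using r(2) k[OF that] by auto
    qed
    then show "\<exists>k. \<forall>m\<ge>k. \<forall>n\<ge>k. - u m - - u n \<in> V" by blast
  qed
qed

lemma (in Metric_space) MCauchy_geometric:
  assumes "range x \<subseteq> M" and step: "\<And>i. d (x i) (x (Suc i)) \<le> (1/2)^i"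
  shows "MCauchy x"
proof -
  have M: "x i \<in> M" for i using assms(1) by auto
  \<comment> \<open>The subtracted term is the tail of the geometric series; it is what lets the
    induction on \<open>k\<close> close.\<close>
  have far: "d (x i) (x (i + k)) \<le> 2 * (1/2)^i - 2 * (1/2)^(i+k)" for i k
  proof (induction k)
    case (Suc k)
    have "d (x i) (x (i + Suc k)) \<le> d (x i) (x (i + k)) + d (x (i + k)) (x (Suc (i + k)))"
      using triangle[of "x i" "x (i + k)" "x (Suc (i + k))"] M by simp
    then show ?case using Suc step[of "i + k"] by simp
  qed (simp add: M)
  show ?thesis
    unfolding MCauchy_def
  proof (intro conjI allI impI assms(1))
    fix e :: real assume e: "e > 0"
    obtain i where i: "(1/2)^i < e/4" using real_arch_pow_inv[of "e/4" "1/2"] e by auto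
    have *: "d (x i) (x m) < e/2" if "i \<le> m" for m
      using far[of i "m - i"] that i zero_less_power[of "1/2::real" m]
      by (simp del: zero_less_power)
    have "d (x n) (x m) < e" if "i \<le> n" "i \<le> m" for n m
      using triangle[of "x n" "x i" "x m"] M *[OF that(1)] *[OF that(2)] commute[of "x n" "x i"]
      by simp
    then show "\<exists>N. \<forall>n n'. N \<le> n \<longrightarrow> N \<le> n' \<longrightarrow> d (x n) (x n') < e" by blast
  qed
qed

text \<open>\<open>W i\<close> is the ball of radius \<open>(1/2)^i\<close> for a complete
  left-invariant metric. The differences \<open>a (Suc i) - a i\<close> measure the distances
  between consecutive inverses, so \<open>- a i\<close> is Cauchy, and its limit gives that of
  \<open>a\<close>.\<close>

lemma CLI_small_steps_convergent:
  assumes "CLI TYPE('h::{topological_group_add, polish_space})"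
  obtains W :: "nat \<Rightarrow> 'h::{topological_group_add, polish_space} set" where "\<And>i. open (W i)" "\<And>i. 0 \<in> W i"
    "\<And>a. (\<And>i. a (Suc i) - a i \<in> W i) \<Longrightarrow> convergent a"
proof -
  obtain d :: "'h \<Rightarrow> 'h \<Rightarrow> real"
    where d: "Metric_space UNIV d" "Metric_space.mtopology UNIV d = euclidean"
    "Metric_space.mcomplete UNIV d" "\<And>g x y. d (g + x) (g + y) = d x y"
    using assms unfolding CLI_def by blast
  interpret Metric_space UNIV d by fact
  show thesis
  proof (rule that[of "\<lambda>i. mball 0 ((1/2)^i)"])
    show "open (mball 0 ((1/2)^i))" for i
      using openin_mball by (simp add: d(2))
    fix a assume a: "\<And>i. a (Suc i) - a i \<in> mball 0 ((1/2)^i)"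
    have step: "d (- a i) (- a (Suc i)) < (1/2)^i" for i
    proof -
      have "d (- a i) (- a (Suc i)) = d (- a (Suc i)) (- a i)" by (rule commute)
      also have "\<dots> = d 0 (a (Suc i) - a i)"
        using d(4)[of "a (Suc i)" "- a (Suc i)" "- a i"] by simp
      finally show ?thesis using a[of i] by simp
    qed
    have "MCauchy (\<lambda>i. - a i)"
      by (rule MCauchy_geometric) (auto intro: less_imp_le step)
    then obtain l where "limitin mtopology (\<lambda>i. - a i) l sequentially"
      using d(3) unfolding mcomplete_def by blast
    then have "(\<lambda>i. - a i) \<longlonglongrightarrow> l" by (simp add: d(2))
    then have "a \<longlonglongrightarrow> - l" using tendsto_minus by fastforce
    then show "convergent a" by (auto simp: convergent_def)
  qed auto
qed

section \<open>Tail translations\<close>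

text \<open>Basic open sets of the product restrict finitely many coordinates. Changes far enough
  out therefore never leave a given open set.\<close>

lemma open_fun_finitely_determined:
  fixes U :: "(nat \<Rightarrow> 'a::topological_space) set"
  assumes "open U" "x \<in> U"
  obtains l where "\<And>y. (\<And>i. i < l \<Longrightarrow> y i = x i) \<Longrightarrow> y \<in> U"
proof -
  have "openin (product_topology (\<lambda>i. euclidean) UNIV) U"
    using assms(1) by (simp add: open_fun_def)
  from product_topology_open_contains_basis[OF this assms(2)]
  have "\<exists>X. x \<in> Pi\<^sub>E UNIV X \<and> (\<forall>i. open (X i)) \<and> finite {i. X i \<noteq> UNIV} \<and> Pi\<^sub>E UNIV X \<subseteq> U"
    by simp
  then obtain X where X: "x \<in> Pi\<^sub>E UNIV X" "finite {i. X i \<noteq> UNIV}" "Pi\<^sub>E UNIV X \<subseteq> U"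
    by blast
  obtain l where l: "\<And>i. X i \<noteq> UNIV \<Longrightarrow> i < l"
    using X(2) unfolding finite_nat_set_iff_bounded by blast
  show thesis
  proof (rule that[of l])
    fix y assume "\<And>i. i < l \<Longrightarrow> y i = x i"
    then have "y \<in> Pi\<^sub>E UNIV X" using X(1) l by (auto simp: PiE_iff) (metis UNIV_I)
    then show "y \<in> U" using X(3) by blast
  qed
qed

text \<open>Translating on the left makes \<open>tail_add m w x n - x n\<close> equal to
  \<open>w\<close> for \<open>n \<ge> m\<close>, so the result is \<open>E_group\<close> related to
  \<open>x\<close>.\<close>

definition tail_add :: "nat \<Rightarrow> 'g::plus \<Rightarrow> (nat \<Rightarrow> 'g) \<Rightarrow> nat \<Rightarrow> 'g" where
  "tail_add m w x = (\<lambda>n. if n < m then x n else w + x n)"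

lemma continuous_on_tail_add: "continuous_on UNIV (tail_add m (w::'g::topological_monoid_add))"
  unfolding tail_add_def
proof (intro continuous_on_coordinatewise_then_product)
  fix n
  show "continuous_on UNIV (\<lambda>x. if n < m then x n else w + x n)"
    by (cases "n < m") (auto intro!: continuous_intros)
qed

lemma tail_add_uminus [simp]:
  fixes w :: "'g::group_add"
  shows "tail_add m w (tail_add m (- w) x) = x" "tail_add m (- w) (tail_add m w x) = x"
  by (auto simp: tail_add_def fun_eq_iff add.assoc[symmetric])

text \<open>The set is the preimage under \<open>(p, q)\<close> of the continuous image of the
  closed set \<open>S \<times> UNIV\<close> under \<open>(h, y) \<mapsto> (y, act h y)\<close>,
  hence of an analytic set.\<close>

lemma Baire_property_orbit_piece:
  fixes act :: "'h::{topological_group_add, polish_space} \<Rightarrow> 'y::polish_space \<Rightarrow> 'y"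
    and p q :: "'a::second_countable_topology \<Rightarrow> 'y"
  assumes "continuous_action act" "closed S" "p \<in> borel_measurable borel" "q \<in> borel_measurable borel"
  shows "Baire_property {x. \<exists>h\<in>S. q x = act h (p x)}"
proof -
  have "Baire_property ((\<lambda>x. (p x, q x)) -` (\<lambda>(h, y). (y, act h y)) ` (S \<times> UNIV))"
  proof (rule Baire_property_vimage_analytic)
    show "(\<lambda>x. (p x, q x)) \<in> borel_measurable borel"
      using assms by (intro borel_measurable_Pair)
    show "closed (S \<times> (UNIV :: 'y set))" using assms(2) by (simp add: closed_Times)
    have "continuous_on (S \<times> UNIV) (\<lambda>(h, y). act h y)"
      using assms(1) unfolding continuous_action_def by (auto intro: continuous_on_subset)
    then show "continuous_on (S \<times> UNIV) (\<lambda>(h, y). (y, act h y))"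
      by (auto simp: case_prod_beta intro!: continuous_intros)
  qed
  moreover have "(\<lambda>x. (p x, q x)) -` (\<lambda>(h, y). (y, act h y)) ` (S \<times> UNIV) = {x. \<exists>h\<in>S. q x = act h (p x)}"
    by force
  ultimately show ?thesis by simp
qed

text \<open>Partial sums, in order, of the terms switched on by \<open>\<epsilon>\<close>. With the
  discrete topology on the bits, \<open>\<epsilon>\<close> ranges over the Cantor set.\<close>

primrec selected_sum :: "(nat \<Rightarrow> 'g::monoid_add) \<Rightarrow> (nat \<Rightarrow> bool discrete) \<Rightarrow> nat \<Rightarrow> 'g" where
  "selected_sum v \<epsilon> 0 = 0"
| "selected_sum v \<epsilon> (Suc k) = selected_sum v \<epsilon> k + (if of_discrete (\<epsilon> k) then v k else 0)"

lemma selected_sum_cong: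
  "(\<And>i. i < k \<Longrightarrow> v i = v' i) \<Longrightarrow> (\<And>i. i < k \<Longrightarrow> \<epsilon> i = \<epsilon>' i) \<Longrightarrow> selected_sum v \<epsilon> k = selected_sum v' \<epsilon>' k"
  by (induction k) auto

text \<open>Uniform smallness of the next term over all \<open>\<epsilon>\<close> is therefore only
  finitely many open conditions.\<close>

lemma finite_range_selected_sum: "finite (range (\<lambda>\<epsilon>. selected_sum v \<epsilon> k))"
proof (induction k)
  case (Suc k)
  have "range (\<lambda>\<epsilon>. selected_sum v \<epsilon> (Suc k)) \<subseteq>
    range (\<lambda>\<epsilon>. selected_sum v \<epsilon> k) \<union> (\<lambda>x. x + v k) ` range (\<lambda>\<epsilon>. selected_sum v \<epsilon> k)"
    by auto
  then show ?case using Suc by (meson finite_UnI finite_imageI finite_subset)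
qed auto

lemma continuous_on_from_discrete: "continuous_on UNIV (g :: 'a discrete \<Rightarrow> 'b::topological_space)"
  by (auto simp: continuous_on_open_vimage open_discrete)

lemma continuous_on_selected_sum:
  "continuous_on UNIV (\<lambda>\<epsilon>. selected_sum (v :: nat \<Rightarrow> 'g::topological_monoid_add) \<epsilon> k)"
proof (induction k)
  case (Suc k)
  have "continuous_on UNIV ((\<lambda>b. if of_discrete b then v k else 0) \<circ> (\<lambda>\<epsilon>::nat \<Rightarrow> bool discrete. \<epsilon> k))"
    by (intro continuous_on_compose continuous_on_product_coordinates
        continuous_on_subset[OF continuous_on_from_discrete]) auto
  then show ?case using Suc by (auto simp: o_def intro!: continuous_intros)
qed auto

text \<open>Switching term \<open>j\<close> on multiplies all later partial sums on the left by one
  fixed element, the conjugate of \<open>v j\<close> by the sum before it.\<close>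

lemma selected_sum_flip:
  fixes v :: "nat \<Rightarrow> 'g::group_add"
  assumes "of_discrete (\<epsilon> j) = False" "j < k"
  shows "selected_sum v (\<epsilon>(j := discrete True)) k
         = selected_sum v \<epsilon> j + v j - selected_sum v \<epsilon> j + selected_sum v \<epsilon> k"
  using Suc_leI[OF assms(2)]
proof (induction k rule: dec_induct)
  case base
  have "selected_sum v (\<epsilon>(j := discrete True)) j = selected_sum v \<epsilon> j"
    by (rule selected_sum_cong) auto
  then show ?case using assms(1) by (simp add: discrete_inverse flip: fun_upd_def)
next
  case (step k)
  then show ?case by (auto simp: add.assoc)
qed

text \<open>Pettis' argument over the Cantor set: a sequence of bad translations that is fast enough
  to make all its ordered partial sums converge yields a continuous family of pairwise equivalent
  points, and on some open set of that family a single translate of a small neighbourhood in the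
  acting group is comeager. Switching one bad translation on contradicts its badness.\<close>

lemma orbit_continuity:
  fixes act :: "'h::{topological_group_add, polish_space} \<Rightarrow> 'y::polish_space \<Rightarrow> 'y"
    and f :: "(nat \<Rightarrow> 'g::{topological_group_add, polish_space}) \<Rightarrow> 'y"
  assumes act: "continuous_action act" and f: "f \<in> borel_measurable borel"
    and hom: "\<forall>x y. E_group x y \<longrightarrow> orbit_rel act (f x) (f y)"
    and W0: "open W0" "0 \<in> W0" and U': "open U'" "U' \<noteq> {}"
  shows "\<exists>U N V. open U \<and> U \<noteq> {} \<and> U \<subseteq> U' \<and> open V \<and> 0 \<in> V \<and>
    (\<forall>w\<in>V. \<forall>m\<ge>N. meager {x\<in>U. \<not> (\<exists>h\<in>W0. f (tail_add m w x) = act h (f x))})"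
proof (rule ccontr)
  assume contra: "\<not> ?thesis"
  obtain r1 where r1: "r1 > 0" "cball 0 r1 \<subseteq> W0" using W0 open_contains_cball by blast
  \<comment> \<open>A closed neighbourhood inside \<open>W0\<close>: closedness gives the orbit
    pieces the Baire property, and failure for \<open>W0\<close> implies failure for the smaller
    \<open>W\<close>.\<close>
  define W where "W = cball (0::'h) r1"
  have "open ((\<lambda>(a, b). a - b) -` ball (0::'h) r1)"
    by (rule open_vimage) (auto simp: case_prod_beta intro!: continuous_intros)
  moreover have "(0, 0) \<in> (\<lambda>(a, b). a - b) -` ball (0::'h) r1" using r1(1) by simp
  ultimately obtain P Q where PQ: "open P" "0 \<in> P" "open Q" "0 \<in> Q" "P \<times> Q \<subseteq> (\<lambda>(a, b). a - b) -` ball (0::'h) r1"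
    by (rule open_prod_elim) auto
  obtain r where r: "r > 0" "cball 0 r \<subseteq> P \<inter> Q"
    using PQ by (metis IntI open_Int open_contains_cball)
  have rW: "a - b \<in> W" if "a \<in> cball 0 r" "b \<in> cball 0 r" for a b
  proof -
    have "(a, b) \<in> P \<times> Q" using that r(2) by blast
    then show ?thesis using PQ(5) by (auto simp: W_def)
  qed
  define bad where "bad m w = {x. \<not> (\<exists>h\<in>W. f (tail_add m w x) = act h (f x))}" for m w
  \<comment> \<open>By the contrary assumption, every nonempty open part of \<open>U'\<close>
    carries bad translations that are arbitrarily small and start arbitrarily far out.\<close>
  have neg: "\<exists>w\<in>V. \<exists>m\<ge>N. \<not> meager (U \<inter> bad m w)"
    if "open U" "U \<noteq> {}" "U \<subseteq> U'" "open V" "0 \<in> V" for U N V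
  proof (rule ccontr)
    assume "\<not> ?thesis"
    then have "meager (U \<inter> bad m w)" if "w \<in> V" "m \<ge> N" for w m using that by blast
    moreover have "{x\<in>U. \<not> (\<exists>h\<in>W0. f (tail_add m w x) = act h (f x))} \<subseteq> U \<inter> bad m w" for w m
      using r1(2) unfolding bad_def W_def by blast
    ultimately have "\<forall>w\<in>V. \<forall>m\<ge>N. meager {x\<in>U. \<not> (\<exists>h\<in>W0. f (tail_add m w x) = act h (f x))}"
      using meager_subset by meson
    then show False using that contra by blast
  qed
  have bad_BP: "Baire_property (bad m w)" for m w
  proof -
    have "(\<lambda>x. f (tail_add m w x)) \<in> borel_measurable borel"
      using borel_measurable_continuous_onI[OF continuous_on_tail_add] f by (rule measurable_compose)
    then have "Baire_property (- {x. \<exists>h\<in>W. f (tail_add m w x) = act h (f x)})"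
      by (intro Baire_property_Compl Baire_property_orbit_piece act f) (auto simp: W_def)
    moreover have "- {x. \<exists>h\<in>W. f (tail_add m w x) = act h (f x)} = bad m w" by (auto simp: bad_def)
    ultimately show ?thesis by simp
  qed
  obtain K :: "(nat \<Rightarrow> 'g) set set" where K: "topological_basis K" "countable K"
      "\<And>k. k \<in> K \<Longrightarrow> \<exists>X. k = Pi\<^sub>E UNIV X \<and> (\<forall>i. open (X i)) \<and> finite {i. X i \<noteq> UNIV}"
    using product_topology_countable_basis by metis
  define B where "B = from_nat_into K"
  define pt where "pt s = (\<lambda>i. discrete (i < length s \<and> s ! i))" for s
  \<comment> \<open>Decodes a finite bit string and the index of a basic open set; the third
    component is a dummy making each such pair occur infinitely often.\<close>
  define code where "code = (from_nat :: nat \<Rightarrow> bool list \<times> nat \<times> nat)"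
  define e where "e g = selected_sum (\<lambda>i. fst (g i))" for g :: "nat \<Rightarrow> 'g \<times> nat"
  \<comment> \<open>Requirements on the pair \<open>(v j, m j)\<close>: later starting place, a
    small step after every possible partial sum, and badness on the coded open set of the conjugate
    of \<open>v j\<close> by the partial sum along the coded string.\<close>
  define G where "G g j vm \<longleftrightarrow> (\<forall>i<j. snd (g i) < snd vm) \<and>
      (\<forall>\<epsilon>. dist (e g \<epsilon> j + fst vm) (e g \<epsilon> j) < (1/2)^j) \<and>
      (open (B (fst (snd (code j)))) \<and> B (fst (snd (code j))) \<noteq> {} \<and> B (fst (snd (code j))) \<subseteq> U' \<longrightarrow>
        \<not> meager (B (fst (snd (code j))) \<inter>
          bad (snd vm) (e g (pt (fst (code j))) j + fst vm - e g (pt (fst (code j))) j)))"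
    for g j and vm :: "'g \<times> nat"
  have "\<exists>g. \<forall>j. G g j (g j)"
  proof (rule dependent_wellorder_choice)
    fix vm :: "'g \<times> nat" and g g' :: "nat \<Rightarrow> 'g \<times> nat" and j :: nat
    assume *: "\<And>i. i < j \<Longrightarrow> g i = g' i"
    then have "e g \<epsilon> j = e g' \<epsilon> j" for \<epsilon> unfolding e_def by (intro selected_sum_cong) auto
    then show "G g j vm = G g' j vm" using * unfolding G_def by simp
  next
    fix j and g :: "nat \<Rightarrow> 'g \<times> nat"
    define N where "N = Suc (\<Sum>i<j. snd (g i))"
    have N: "snd (g i) < m" if "i < j" "N \<le> m" for i m
      using member_le_sum[of i "{..<j}" "\<lambda>i. snd (g i)"] that by (auto simp: N_def)
    define V where "V = (\<Inter>x\<in>range (\<lambda>\<epsilon>. e g \<epsilon> j). {v. dist (x + v) x < (1/2)^j})"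
    have V: "open V" "0 \<in> V"
    proof -
      have "open {v. dist (x + v) x < (1/2)^j}" for x :: 'g
        by (intro open_Collect_less continuous_intros)
      then show "open V" unfolding V_def e_def using finite_range_selected_sum
        by (intro open_INT) auto
    qed (auto simp: V_def)
    define U where "U = B (fst (snd (code j)))"
    define es where "es = e g (pt (fst (code j))) j"
    show "\<exists>vm. G g j vm"
    proof (cases "open U \<and> U \<noteq> {} \<and> U \<subseteq> U'")
      case True
      \<comment> \<open>The bad element \<open>w\<close> is chosen first and conjugated back, so
        that the later conjugation by \<open>es\<close> returns \<open>w\<close> itself.\<close>
      have "open ((\<lambda>w. - es + w + es) -` V)"
        using V(1) by (rule open_vimage) (auto intro!: continuous_intros)
      moreover have "0 \<in> (\<lambda>w. - es + w + es) -` V" using V by simp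
      ultimately obtain w m where w: "w \<in> (\<lambda>w. - es + w + es) -` V" "m \<ge> N" "\<not> meager (U \<inter> bad m w)"
        using neg[of U] True by blast
      have "es + (- es + w + es) - es = w" by (simp add: add.assoc[symmetric])
      then have "G g j (- es + w + es, m)"
        using w N unfolding G_def es_def[symmetric] U_def[symmetric] by (auto simp: V_def)
      then show ?thesis by blast
    next
      case False
      have "G g j (0, N)"
        using False N unfolding G_def U_def[symmetric] by auto
      then show ?thesis by blast
    qed
  qed
  then obtain g where g: "\<And>j. G g j (g j)" by blast
  define v where "v = (\<lambda>i. fst (g i))"
  define m where "m i = snd (g i)" for i
  define S where "S = selected_sum v"
  have eS: "e g = S" by (simp add: e_def S_def v_def)
  have m_mono: "strict_mono m"
    using g unfolding G_def m_def strict_mono_def by blast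
  have near: "dist (S \<epsilon> j + v j) (S \<epsilon> j) < (1/2)^j" for \<epsilon> j
    using g[of j] unfolding G_def eS v_def by blast
  \<comment> \<open>\<open>c n\<close> counts the \<open>j\<close> with \<open>m j \<le> n\<close>:
    coordinate \<open>n\<close> sees the term \<open>v j\<close> exactly from \<open>m j\<close>
    on.\<close>
  define c where "c n = (LEAST j. n < m j)" for n
  have c: "j < c n \<longleftrightarrow> m j \<le> n" for j n
  proof -
    have "n < m (Suc n)" using strict_mono_imp_increasing[OF m_mono, of "Suc n"] by simp
    then have "n < m (c n)" unfolding c_def by (rule LeastI)
    then show ?thesis using not_less_Least[of j "\<lambda>j. n < m j"] strict_mono_less[OF m_mono, of j "c n"]
      unfolding c_def[symmetric] by auto
  qed
  have "convergent (S \<epsilon>)" for \<epsilon>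
  proof -
    have "Met_TC.MCauchy (S \<epsilon>)"
    proof (rule Met_TC.MCauchy_geometric)
      show "dist (S \<epsilon> j) (S \<epsilon> (Suc j)) \<le> (1/2)^j" for j
        using near[of \<epsilon> j] by (auto simp: S_def dist_commute)
    qed auto
    then show ?thesis by (simp add: Cauchy_convergent_iff)
  qed
  moreover have "filterlim c at_top sequentially"
    unfolding filterlim_at_top
  proof
    fix j show "\<forall>\<^sub>F n in sequentially. j \<le> c n"
      by (rule eventually_sequentiallyI[of "m j"]) (use c in \<open>simp add: less_imp_le\<close>)
  qed
  ultimately have conv: "convergent (\<lambda>n. S \<epsilon> (c n))" for \<epsilon>
    unfolding convergent_def using filterlim_compose by blast
  \<comment> \<open>\<open>F\<close> strips the selected sums off the sequence. These sums converge,
    so \<open>F p\<close> stays equivalent to \<open>fst p\<close>, whatever bits are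
    chosen.\<close>
  define F where "F p = (\<lambda>n. - S (snd p) (c n) + fst p n)" for p :: "(nat \<Rightarrow> 'g) \<times> (nat \<Rightarrow> bool discrete)"
  have F_cont: "continuous_on UNIV F"
    unfolding F_def S_def
  proof (rule continuous_on_coordinatewise_then_product)
    fix n
    have "continuous_on UNIV (\<lambda>p::(nat \<Rightarrow> 'g) \<times> (nat \<Rightarrow> bool discrete). selected_sum v (snd p) (c n))"
      by (rule continuous_on_compose2[OF continuous_on_selected_sum]) (auto intro: continuous_intros)
    moreover have "continuous_on UNIV (\<lambda>p::(nat \<Rightarrow> 'g) \<times> (nat \<Rightarrow> bool discrete). fst p n)"
      by (rule continuous_on_compose2[OF continuous_on_product_coordinates]) (auto intro: continuous_intros)
    ultimately show "continuous_on UNIV (\<lambda>p. - selected_sum v (snd p) (c n) + fst p n)"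
      by (intro continuous_on_add continuous_on_minus)
  qed
  have F_orbit: "orbit_rel act (f (F p)) (f (fst p))" for p
  proof -
    have "(\<lambda>n. F p n - fst p n) = (\<lambda>n. - S (snd p) (c n))" by (simp add: F_def fun_eq_iff)
    moreover have "convergent (\<lambda>n. - S (snd p) (c n))"
      using conv[of "snd p"] unfolding convergent_def using tendsto_minus by blast
    ultimately show ?thesis by (intro hom[rule_format]) (simp add: E_group_def)
  qed
  obtain D :: "'h set" where D: "countable D" "\<And>U. open U \<Longrightarrow> U \<noteq> {} \<Longrightarrow> \<exists>d\<in>D. d \<in> U"
    using countable_dense_setE by metis
  \<comment> \<open>The acting group is covered by countably many right translates of a small ball;
    \<open>A b\<close> collects the \<open>p\<close> for which one of these leads from
    \<open>f (F p)\<close> to \<open>f (fst p)\<close>.\<close>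
  define A where "A b = {p. \<exists>h\<in>(\<lambda>h. h - b) -` cball 0 r. f (fst p) = act h (f (F p))}" for b
  have A_BP: "Baire_property (A b)" for b
    unfolding A_def
  proof (rule Baire_property_orbit_piece[OF act])
    show "closed ((\<lambda>h. h - b) -` cball 0 r)"
      by (rule closed_vimage) (auto intro!: continuous_intros)
    show "(\<lambda>p. f (F p)) \<in> borel_measurable borel"
      using borel_measurable_continuous_onI[OF F_cont] f by (rule measurable_compose)
    have "(fst :: (nat \<Rightarrow> 'g) \<times> (nat \<Rightarrow> bool discrete) \<Rightarrow> _) \<in> borel_measurable borel"
      by (rule borel_measurable_continuous_onI) (intro continuous_intros)
    then show "(\<lambda>p::(nat \<Rightarrow> 'g) \<times> (nat \<Rightarrow> bool discrete). f (fst p)) \<in> borel_measurable borel"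
      using f by (rule measurable_compose)
  qed
  have A_cover: "p \<in> (\<Union>b\<in>D. A b)" for p
  proof -
    obtain h where h: "f (fst p) = act h (f (F p))" using F_orbit[of p] unfolding orbit_rel_def by metis
    have "open ((\<lambda>b. h - b) -` ball 0 r)"
      by (rule open_vimage) (auto intro!: continuous_intros)
    moreover have "h \<in> (\<lambda>b. h - b) -` ball 0 r" using r(1) by simp
    ultimately obtain b where "b \<in> D" "h - b \<in> ball 0 r" using D(2) by blast
    then show ?thesis using h by (force simp: A_def)
  qed
  have "\<not> meager (U' \<times> (UNIV :: (nat \<Rightarrow> bool discrete) set))"
    by (rule not_meager_open) (use U' in \<open>auto simp: open_Times\<close>)
  moreover have "U' \<times> UNIV \<subseteq> (\<Union>b\<in>D. A b \<inter> U' \<times> UNIV)" using A_cover by blast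
  ultimately have "\<exists>b\<in>D. \<not> meager (A b \<inter> U' \<times> UNIV)"
    using meager_UNION[OF D(1), of "\<lambda>b. A b \<inter> U' \<times> UNIV"] meager_subset by blast
  then obtain b where b: "\<not> meager (A b \<inter> U' \<times> UNIV)" by blast
  obtain Ob where Ob: "open Ob" "Ob \<noteq> {}" "Ob \<subseteq> U' \<times> UNIV" "meager (Ob - A b)"
    by (rule nonmeager_Baire_property_comeager_in_open[OF A_BP b]) (use U' in \<open>auto simp: open_Times\<close>)
  obtain z0 \<epsilon>0 where z0: "(z0, \<epsilon>0) \<in> Ob" using Ob(2) by auto
  obtain O1 O2 where O12: "open O1" "z0 \<in> O1" "open O2" "\<epsilon>0 \<in> O2" "O1 \<times> O2 \<subseteq> Ob"
    using open_prod_elim[OF Ob(1) z0] by (metis mem_Sigma_iff)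
  obtain k where k: "k \<in> K" "z0 \<in> k" "k \<subseteq> O1"
    using K(1) O12 topological_basisE by metis
  obtain l where l: "\<And>\<epsilon>. (\<And>i. i < l \<Longrightarrow> \<epsilon> i = \<epsilon>0 i) \<Longrightarrow> \<epsilon> \<in> O2"
    using open_fun_finitely_determined[OF O12(3,4)] by metis
  obtain X where X: "k = Pi\<^sub>E UNIV X" "finite {i. X i \<noteq> UNIV}" using K(3)[OF k(1)] by blast
  obtain q where q: "\<And>i. X i \<noteq> UNIV \<Longrightarrow> i < q"
    using X(2) unfolding finite_nat_set_iff_bounded by blast
  define s where "s = map (\<lambda>i. of_discrete (\<epsilon>0 i)) [0..<l]"
  obtain a where a: "B a = k" using from_nat_into_surj[OF K(2) k(1)] unfolding B_def by blast
  \<comment> \<open>The dummy component allows \<open>j\<close> beyond \<open>l + q\<close>: then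
    changing bit \<open>j\<close> stays inside \<open>O2\<close>, and a tail translation from
    \<open>m j\<close> on stays inside \<open>k\<close>.\<close>
  have "infinite (range (\<lambda>x::nat. to_nat (s, a, x)))"
    by (rule range_inj_infinite) (auto simp: inj_on_def)
  then obtain j where j: "j > l + q" "j \<in> range (\<lambda>x::nat. to_nat (s, a, x))"
    by (meson infinite_nat_iff_unbounded)
  then have code_j: "fst (code j) = s" "fst (snd (code j)) = a" by (auto simp: code_def)
  have pt: "pt s i = \<epsilon>0 i" if "i < l" for i using that by (simp add: pt_def s_def of_discrete_inverse)
  have pt_j: "of_discrete (pt s j) = False" using j(1) by (simp add: pt_def s_def discrete_inverse)
  define w where "w = S (pt s) j + v j - S (pt s) j"
  have "open k" using k(1) K(1) topological_basis_open by blast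
  moreover have "k \<noteq> {}" "k \<subseteq> U'" using k O12 Ob(3) by blast+
  ultimately have "\<not> meager (k \<inter> bad (m j) w)"
    using g[of j] unfolding G_def code_j a eS w_def v_def m_def by blast
  then obtain U3 where U3: "open U3" "U3 \<noteq> {}" "U3 \<subseteq> k" "meager (U3 - bad (m j) w)"
    using nonmeager_Baire_property_comeager_in_open[OF bad_BP _ \<open>open k\<close>] by (metis Int_commute)
  define flip where "flip \<epsilon> = \<epsilon>(j := discrete (\<not> of_discrete (\<epsilon> j)))" for \<epsilon> :: "nat \<Rightarrow> bool discrete"
  \<comment> \<open>\<open>\<Psi>\<close> translates the tail and flips bit \<open>j\<close>
    together. It is a homeomorphism, and turning bit \<open>j\<close> on this way leaves
    \<open>F\<close> unchanged.\<close>
  define \<Psi> where "\<Psi> p = (tail_add (m j) w (fst p), flip (snd p))" for p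
  have flip_cont: "continuous_on UNIV flip"
    unfolding flip_def
  proof (intro continuous_on_coordinatewise_then_product)
    fix i
    have "continuous_on UNIV ((\<lambda>b. discrete (\<not> of_discrete b)) \<circ> (\<lambda>\<epsilon>::nat \<Rightarrow> bool discrete. \<epsilon> j))"
      by (intro continuous_on_compose continuous_on_product_coordinates
          continuous_on_subset[OF continuous_on_from_discrete]) auto
    then show "continuous_on UNIV (\<lambda>\<epsilon>. (\<epsilon>(j := discrete (\<not> of_discrete (\<epsilon> j)))) i)"
      by (cases "i = j") (auto simp: o_def)
  qed
  have "meager (\<Psi> -` (Ob - A b))"
  proof (rule meager_vimage_homeomorphism[where k = "\<lambda>p. (tail_add (m j) (- w) (fst p), flip (snd p))"])
    show "continuous_on UNIV \<Psi>" unfolding \<Psi>_def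
      by (intro continuous_intros continuous_on_compose2[OF continuous_on_tail_add]
          continuous_on_compose2[OF flip_cont]) auto
    show "continuous_on UNIV (\<lambda>p. (tail_add (m j) (- w) (fst p), flip (snd p)))"
      by (intro continuous_intros continuous_on_compose2[OF continuous_on_tail_add]
          continuous_on_compose2[OF flip_cont]) auto
    have "flip (flip \<epsilon>) = \<epsilon>" for \<epsilon> by (simp add: flip_def discrete_inverse of_discrete_inverse)
    then show "\<Psi> (tail_add (m j) (- w) (fst p), flip (snd p)) = p"
      "(tail_add (m j) (- w) (fst (\<Psi> p)), flip (snd (\<Psi> p))) = p" for p
      by (auto simp: \<Psi>_def)
  qed (rule Ob(4))
  then have "meager (fst -` (U3 - bad (m j) w) \<union> (Ob - A b) \<union> \<Psi> -` (Ob - A b))"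
    by (intro meager_Un meager_vimage_fst U3(4) Ob(4))
  \<comment> \<open>The cylinder includes coordinate \<open>j\<close>, so bit \<open>j\<close> is
    off and the partial sum before it is the one along \<open>s\<close>.\<close>
  moreover define Q' where "Q' = {\<epsilon>. \<forall>i\<in>{..j}. \<epsilon> i = pt s i}"
  have "U3 \<times> Q' \<subseteq> fst -` (U3 - bad (m j) w) \<union> (Ob - A b) \<union> \<Psi> -` (Ob - A b)"
  proof (rule subsetI, rule ccontr)
    fix p assume p: "p \<in> U3 \<times> Q'"
      and *: "p \<notin> fst -` (U3 - bad (m j) w) \<union> (Ob - A b) \<union> \<Psi> -` (Ob - A b)"
    obtain z \<epsilon> where zp: "p = (z, \<epsilon>)" by (cases p)
    have z: "z \<in> bad (m j) w" "z \<in> k" "z \<in> U3" and \<epsilon>: "\<And>i. i \<le> j \<Longrightarrow> \<epsilon> i = pt s i"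
      using p * U3(3) by (auto simp: zp Q'_def)
    have \<epsilon>j: "of_discrete (\<epsilon> j) = False" using \<epsilon>[of j] pt_j by simp
    then have flip: "flip \<epsilon> = \<epsilon>(j := discrete True)" by (simp add: flip_def)
    have "\<epsilon> \<in> O2" "flip \<epsilon> \<in> O2" using \<epsilon> pt j(1) by (auto intro!: l simp: flip)
    moreover have "tail_add (m j) w z \<in> k"
    proof -
      have "j \<le> m j" using strict_mono_imp_increasing[OF m_mono] by blast
      then have "i < m j" if "X i \<noteq> UNIV" for i using q[OF that] j(1) by linarith
      then have "tail_add (m j) w z i \<in> X i" for i
        using z(2) by (cases "X i = UNIV") (auto simp: X(1) tail_add_def)
      then show ?thesis by (auto simp: X(1))
    qed
    ultimately have "p \<in> Ob" "\<Psi> p \<in> Ob" using z k(3) O12(5) by (auto simp: zp \<Psi>_def)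
    then have pA: "p \<in> A b" "\<Psi> p \<in> A b" using * by auto
    have "S \<epsilon> j = S (pt s) j" unfolding S_def by (rule selected_sum_cong) (use \<epsilon> in auto)
    then have "S (flip \<epsilon>) i = w + S \<epsilon> i" if "j < i" for i
      using selected_sum_flip[of \<epsilon> j i v, OF \<epsilon>j that] by (simp add: flip w_def S_def)
    moreover have "S (flip \<epsilon>) i = S \<epsilon> i" if "i \<le> j" for i
      unfolding S_def flip by (rule selected_sum_cong) (use that in auto)
    \<comment> \<open>From coordinate \<open>m j\<close> on, the sum and the sequence both gain
      \<open>w\<close> on the left, and it cancels; before \<open>m j\<close> nothing
      changes.\<close>
    ultimately have "F (\<Psi> p) n = F p n" for n
      using c[of j n] by (cases "n < m j") (auto simp: F_def \<Psi>_def zp tail_add_def minus_add not_le simp flip: add.assoc)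
    then have "F (\<Psi> p) = F p" by blast
    then obtain h1 h2 where h: "h1 - b \<in> cball 0 r" "f z = act h1 (f (F p))"
        "h2 - b \<in> cball 0 r" "f (tail_add (m j) w z) = act h2 (f (F p))"
      using pA by (auto simp: A_def \<Psi>_def zp)
    \<comment> \<open>The unknown translate \<open>b\<close> cancels, leaving an element of
      \<open>W\<close> that moves \<open>f z\<close> to the translated value.\<close>
    have "h2 - b - (h1 - b) = h2 - h1" by (simp add: diff_diff_eq2)
    then have "h2 - h1 \<in> W" using rW[OF h(3,1)] by simp
    moreover have "f (tail_add (m j) w z) = act (h2 - h1) (f z)"
      using act h(2,4) unfolding continuous_action_def by (metis diff_add_cancel)
    ultimately show False using z(1) by (auto simp: bad_def)
  qed
  ultimately have "meager (U3 \<times> Q')" by (rule meager_subset)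
  moreover have "open Q'"
  proof -
    have "Q' = (\<Inter>i\<in>{..j}. (\<lambda>\<epsilon>. \<epsilon> i) -` {pt s i})" by (auto simp: Q'_def)
    moreover have "open ((\<lambda>\<epsilon>. \<epsilon> i) -` {pt s i})" for i
      by (intro open_vimage open_discrete continuous_on_product_coordinates)
    ultimately show ?thesis by (simp add: open_INT)
  qed
  moreover have "pt s \<in> Q'" by (simp add: Q'_def)
  ultimately show False using not_meager_open[of "U3 \<times> Q'"] U3(1,2) by (auto simp: open_Times)
qed

section \<open>Assembling the contradiction at a limit point\<close>

lemma right_Cauchy_tendsto_subseq:
  fixes g :: "nat \<Rightarrow> 'g::topological_group_add"
  assumes Cauchy: "\<And>V. open V \<Longrightarrow> 0 \<in> V \<Longrightarrow> \<exists>k. \<forall>m\<ge>k. \<forall>n\<ge>k. g m - g n \<in> V"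
    and k: "strict_mono k" and lim: "(g \<circ> k) \<longlonglongrightarrow> L"
  shows "g \<longlonglongrightarrow> L"
proof (rule topological_tendstoI)
  fix U assume U: "open U" "L \<in> U"
  have "open ((\<lambda>(a, b). a + b) -` U)"
    using U(1) by (rule open_vimage) (auto simp: case_prod_beta intro!: continuous_intros)
  moreover have "(0, L) \<in> (\<lambda>(a, b). a + b) -` U" using U by simp
  ultimately obtain P Q where PQ: "open P" "0 \<in> P" "open Q" "L \<in> Q" "P \<times> Q \<subseteq> (\<lambda>(a, b). a + b) -` U"
    by (rule open_prod_elim) auto
  obtain k0 where k0: "\<And>m n. m \<ge> k0 \<Longrightarrow> n \<ge> k0 \<Longrightarrow> g m - g n \<in> P" using Cauchy[OF PQ(1,2)] by blast
  have "eventually (\<lambda>i. g (k i) \<in> Q) sequentially"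
    using topological_tendstoD[OF lim PQ(3,4)] by simp
  then obtain i0 where i0: "\<And>i. i \<ge> i0 \<Longrightarrow> g (k i) \<in> Q" by (auto simp: eventually_sequentially)
  define i where "i = max i0 k0"
  have i: "g (k i) \<in> Q" "k i \<ge> k0"
    using i0[of i] strict_mono_imp_increasing[OF k, of i] by (auto simp: i_def)
  show "eventually (\<lambda>n. g n \<in> U) sequentially"
  proof (rule eventually_sequentiallyI)
    fix m assume "k0 \<le> m"
    then have "(g m - g (k i), g (k i)) \<in> P \<times> Q" using i k0 by blast
    then show "g m \<in> U" using PQ(5) by auto
  qed
qed

text \<open>\<open>R\<close> consists of the points that no finite word in the maps
  \<open>T i\<close> sends into \<open>M\<close>. There are countably many words, each a
  homeomorphism.\<close>

lemma comeager_invariant_subset: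
  fixes T :: "'i::countable \<Rightarrow> 'a::topological_space \<Rightarrow> 'a"
  assumes "\<And>i. continuous_on UNIV (T i)" "\<And>i. continuous_on UNIV (T' i)"
    "\<And>i x. T i (T' i x) = x" "\<And>i x. T' i (T i x) = x" "meager M"
  obtains R where "meager (- R)" "R \<inter> M = {}" "\<And>i x. x \<in> R \<Longrightarrow> T i x \<in> R"
proof -
  define R where "R = {x. \<forall>L. foldr T L x \<notin> M}"
  have pre: "meager (foldr T L -` A)" if "meager A" for L A
    using that
  proof (induction L arbitrary: A)
    case (Cons i L)
    have "meager (T i -` A)"
      using assms Cons.prems by (intro meager_vimage_homeomorphism[of "T i" "T' i"])
    then have "meager (foldr T L -` (T i -` A))" by (rule Cons.IH)
    then show ?case by (simp add: vimage_def)
  qed (simp add: vimage_def)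
  have "- R = (\<Union>L. foldr T L -` M)" by (auto simp: R_def)
  then have "meager (- R)"
    using meager_UNION[of UNIV "\<lambda>L. foldr T L -` M"] pre[OF assms(5)] by simp
  moreover have "R \<inter> M = {}"
  proof -
    have "x \<notin> M" if "x \<in> R" for x using that foldr.simps(1)[of T] unfolding R_def by (metis id_apply mem_Collect_eq)
    then show ?thesis by blast
  qed
  moreover have "T i x \<in> R" if "x \<in> R" for i x
  proof -
    have "foldr T L (T i x) \<notin> M" for L
      using that[unfolded R_def, simplified, THEN spec, of "L @ [i]"] by simp
    then show ?thesis by (simp add: R_def)
  qed
  ultimately show thesis by (rule that)
qed

theorem theorem1p2:
  fixes act :: "'h::{topological_group_add, polish_space} \<Rightarrow> 'y::polish_space \<Rightarrow> 'y"
  assumes "\<not> CLI TYPE('g::{topological_group_add, polish_space})"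
    and "CLI TYPE('h)"
    and "continuous_action act"
  shows "\<not> ((E_group :: (nat \<Rightarrow> 'g) \<Rightarrow> (nat \<Rightarrow> 'g) \<Rightarrow> bool) \<le>\<^sub>B orbit_rel act)"
proof
  assume "(E_group :: (nat \<Rightarrow> 'g) \<Rightarrow> (nat \<Rightarrow> 'g) \<Rightarrow> bool) \<le>\<^sub>B orbit_rel act"
  then obtain f :: "(nat \<Rightarrow> 'g) \<Rightarrow> 'y" where f: "f \<in> borel_measurable borel"
      "\<And>x y. E_group x y \<longleftrightarrow> orbit_rel act (f x) (f y)"
    unfolding borel_reducible_def by blast
  then have hom: "\<forall>x y. E_group x y \<longrightarrow> orbit_rel act (f x) (f y)" by blast
  obtain g :: "nat \<Rightarrow> 'g" where g: "\<not> convergent g"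
      "\<And>V. open V \<Longrightarrow> 0 \<in> V \<Longrightarrow> \<exists>k. \<forall>m\<ge>k. \<forall>n\<ge>k. g m - g n \<in> V"
    using not_CLI_right_Cauchy_divergent[OF assms(1)] by metis
  obtain W :: "nat \<Rightarrow> 'h set" where W: "\<And>i. open (W i)" "\<And>i. 0 \<in> W i"
      "\<And>a. (\<And>i. a (Suc i) - a i \<in> W i) \<Longrightarrow> convergent a"
    using CLI_small_steps_convergent[OF assms(2)] by metis
  define V where "V q = ball (0::'g) (inverse (Suc q))" for q :: nat
  obtain K :: "(nat \<Rightarrow> 'g) set set" where K: "countable K" "topological_basis K"
    using ex_countable_basis by auto
  define bad where "bad i m w = {x. \<not> (\<exists>h\<in>W i. f (tail_add m w x) = act h (f x))}" for i m w
  \<comment> \<open>An open set on which \<open>orbit_continuity\<close> holds at level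
    \<open>i\<close> with bounds \<open>N\<close> and \<open>q\<close>, assembled from basic sets so
    that only countably many exceptional sets arise.\<close>
  define good where "good i N q = \<Union>{k\<in>K. \<forall>w\<in>V q. \<forall>m\<ge>N. meager (k \<inter> bad i m w)}" for i N q
  have good_open: "open (good i N q)" for i N q
    unfolding good_def using topological_basis_open[OF K(2)] by (intro open_Union) auto
  have good_bad: "meager (good i N q \<inter> bad i m w)" if "w \<in> V q" "m \<ge> N" for i N q m w
  proof -
    have "meager (\<Union>k\<in>{k\<in>K. \<forall>w\<in>V q. \<forall>m\<ge>N. meager (k \<inter> bad i m w)}. k \<inter> bad i m w)"
      using K(1) that by (intro meager_UNION) auto
    then show ?thesis by (rule meager_subset) (auto simp: good_def)
  qed
  \<comment> \<open>Inside an open set missing all \<open>good i N q\<close>,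
    \<open>orbit_continuity\<close> would produce a basic open set belonging to one of them.\<close>
  have good_dense: "meager (- (\<Union>N q. good i N q))" for i
  proof (rule meager_closed)
    show "closed (- (\<Union>N q. good i N q))" unfolding closed_def using good_open by (simp add: open_UN)
    show "interior (- (\<Union>N q. good i N q)) = {}"
    proof (rule ccontr)
      assume ne: "interior (- (\<Union>N q. good i N q)) \<noteq> {}"
      from orbit_continuity[OF assms(3) f(1) hom W(1)[of i] W(2)[of i] open_interior ne]
      obtain U N V' where U: "open U" "U \<noteq> {}" "U \<subseteq> interior (- (\<Union>N q. good i N q))" "open V'" "0 \<in> V'"
          "\<forall>w\<in>V'. \<forall>m\<ge>N. meager {x\<in>U. \<not> (\<exists>h\<in>W i. f (tail_add m w x) = act h (f x))}"
        by (elim exE conjE) (rule that)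
      obtain e where "e > 0" "ball 0 e \<subseteq> V'" using U(4,5) open_contains_ball by blast
      moreover obtain q where "inverse (real (Suc q)) < e" using reals_Archimedean \<open>e > 0\<close> by blast
      ultimately have q: "V q \<subseteq> V'" by (auto simp: V_def)
      obtain x where x: "x \<in> U" using U(2) by blast
      obtain k where k: "k \<in> K" "x \<in> k" "k \<subseteq> U" using x U(1) K(2) topological_basisE by metis
      have "meager (k \<inter> bad i m w)" if "w \<in> V q" "m \<ge> N" for w m
        using U(6)[rule_format, OF subsetD[OF q that(1)] that(2)]
        by (rule meager_subset) (use k(3) in \<open>auto simp: bad_def\<close>)
      then have "x \<in> good i N q" using k unfolding good_def by blast
      then show False using x U(3) interior_subset by blast
    qed
  qed
  obtain M1 where M1: "meager M1" "continuous_on (- M1) f"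
    using borel_measurable_continuous_off_meager[OF f(1)] by blast
  \<comment> \<open>Avoiding a single closed \<open>F n\<close> is an open condition, so it can be
    secured for the limit by fixing finitely many coordinates.\<close>
  obtain F :: "nat \<Rightarrow> (nat \<Rightarrow> 'g) set" where F: "\<And>n. closed (F n)" "\<And>n. interior (F n) = {}" "M1 \<subseteq> (\<Union>n. F n)"
    using M1(1) unfolding meager_def by blast
  have f_cont: "continuous_on (- (\<Union>n. F n)) f"
    by (rule continuous_on_subset[OF M1(2)]) (use F in auto)
  \<comment> \<open>Only the countably many translations by some \<open>g a - g b\<close> are
    considered, so their exceptional sets have a meager union.\<close>
  define ix :: "(nat \<times> nat \<times> nat \<times> nat \<times> nat \<times> nat) set"
    where "ix = {(i, N, q, m, a, b). g a - g b \<in> V q \<and> m \<ge> N}"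
  define M where "M = (\<Union>n. F n) \<union> (\<Union>i. - (\<Union>N q. good i N q)) \<union>
     (\<Union>(i, N, q, m, a, b)\<in>ix. good i N q \<inter> bad i m (g a - g b))"
  have "meager M"
    unfolding M_def
  proof (intro meager_Un meager_UN good_dense)
    show "meager (F n)" for n using F by (intro meager_closed)
    show "meager (\<Union>(i, N, q, m, a, b)\<in>ix. good i N q \<inter> bad i m (g a - g b))"
      by (rule meager_UNION) (auto simp: ix_def intro: good_bad)
  qed
  obtain R where R: "meager (- R)" "R \<inter> M = {}"
      "\<And>m a b x. x \<in> R \<Longrightarrow> tail_add m (g a - g b) x \<in> R"
  proof (rule comeager_invariant_subset[of "\<lambda>(m, a, b). tail_add m (g a - g b)"
      "\<lambda>(m, a, b). tail_add m (- (g a - g b))" M])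
    fix R assume "meager (- R)" "R \<inter> M = {}"
      "\<And>i x. x \<in> R \<Longrightarrow> (case i of (m, a, b) \<Rightarrow> tail_add m (g a - g b)) x \<in> R"
    then show thesis using that[of R] by fastforce
  qed (use \<open>meager M\<close> in \<open>auto simp del: minus_diff_eq intro: continuous_on_tail_add\<close>)
  have R_good: "\<exists>N q. x \<in> good i N q" if "x \<in> R" for x i
    using that R(2) unfolding M_def by blast
  have R_step: "\<exists>h\<in>W i. f (tail_add m (g a - g b) x) = act h (f x)"
    if "x \<in> R" "x \<in> good i N q" "g a - g b \<in> V q" "m \<ge> N" for x i N q m a b
  proof -
    have "(i, N, q, m, a, b) \<in> ix" using that by (auto simp: ix_def)
    then have "x \<notin> good i N q \<inter> bad i m (g a - g b)" using that(1) R(2) unfolding M_def by blast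
    then show ?thesis using that(2) unfolding bad_def by blast
  qed
  have R_F: "x \<notin> F n" if "x \<in> R" for x n using that R(2) unfolding M_def by blast
  have tail: "\<exists>k\<ge>l. \<forall>a\<ge>k. g a - g k \<in> V q" for q l
  proof -
    obtain k where "\<forall>m\<ge>k. \<forall>n\<ge>k. g m - g n \<in> V q" using g(2)[of "V q"] by (auto simp: V_def)
    then show ?thesis by (intro exI[of _ "max k l"]) auto
  qed
  have "R \<noteq> {}" using R(1) not_meager_open[of "UNIV :: (nat \<Rightarrow> 'g) set"] by auto
  \<comment> \<open>A state holds the current point \<open>x\<close>, the index \<open>k\<close>
    reached in \<open>g\<close>, bounds \<open>N\<close> and \<open>q\<close> for goodness at level
    \<open>i\<close>, and the start \<open>m\<close> of the last translation. The choice of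
    \<open>k\<close> makes every later \<open>g a - g k\<close> small enough to be the next
    translation.\<close>
  have "\<exists>\<sigma> :: nat \<Rightarrow> (nat \<Rightarrow> 'g) \<times> nat \<times> nat \<times> nat \<times> nat. \<forall>i.
     (case \<sigma> i of (x, k, N, q, m) \<Rightarrow> x \<in> R \<and> x \<in> good i N q \<and> (\<forall>a\<ge>k. g a - g k \<in> V q)) \<and>
     (case (\<sigma> i, \<sigma> (Suc i)) of ((x, k, N, q, m), (x', k', N', q', m')) \<Rightarrow>
        m < m' \<and> k < k' \<and> x' = tail_add m' (g k' - g k) x \<and> (\<exists>h\<in>W i. f x' = act h (f x)) \<and>
        (\<forall>z. (\<forall>n<m'. z n = x n) \<longrightarrow> z \<notin> F i))"
  proof (rule dependent_nat_choice)
    obtain x where x: "x \<in> R" using \<open>R \<noteq> {}\<close> by blast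
    obtain N q where "x \<in> good 0 N q" using R_good[OF x] by blast
    moreover obtain k where "\<forall>a\<ge>k. g a - g k \<in> V q" using tail by blast
    ultimately show "\<exists>\<sigma> :: (nat \<Rightarrow> 'g) \<times> nat \<times> nat \<times> nat \<times> nat.
      case \<sigma> of (x, k, N, q, m) \<Rightarrow> x \<in> R \<and> x \<in> good 0 N q \<and> (\<forall>a\<ge>k. g a - g k \<in> V q)"
      using x by (intro exI[of _ "(x, k, N, q, 0)"]) auto
  next
    fix \<sigma> :: "(nat \<Rightarrow> 'g) \<times> nat \<times> nat \<times> nat \<times> nat" and i
    obtain x k N q m where \<sigma>: "\<sigma> = (x, k, N, q, m)" by (cases \<sigma>)
    assume "case \<sigma> of (x, k, N, q, m) \<Rightarrow> x \<in> R \<and> x \<in> good i N q \<and> (\<forall>a\<ge>k. g a - g k \<in> V q)"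
    then have x: "x \<in> R" "x \<in> good i N q" "\<And>a. a \<ge> k \<Longrightarrow> g a - g k \<in> V q" by (auto simp: \<sigma>)
    \<comment> \<open>The next bounds come from the old point, since \<open>k'\<close> must suit
      \<open>q'\<close> before the new point is formed; translating beyond \<open>l\<close> keeps
      the new point good for them.\<close>
    obtain N' q' where N': "x \<in> good (Suc i) N' q'" using R_good[OF x(1)] by blast
    obtain k' where k': "k' \<ge> Suc k" "\<forall>a\<ge>k'. g a - g k' \<in> V q'" using tail by blast
    obtain l where l: "\<And>z. (\<And>n. n < l \<Longrightarrow> z n = x n) \<Longrightarrow> z \<in> good (Suc i) N' q'"
      using open_fun_finitely_determined[OF good_open N'] by metis
    have "open (- F i)" "x \<in> - F i" using F(1) R_F[OF x(1)] by auto
    then obtain l' where l': "\<And>z. (\<And>n. n < l' \<Longrightarrow> z n = x n) \<Longrightarrow> z \<notin> F i"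
      using open_fun_finitely_determined by (metis ComplD)
    define m' where "m' = Suc m + N + l + l'"
    define x' where "x' = tail_add m' (g k' - g k) x"
    have "x' \<in> R" unfolding x'_def using R(3) x(1) by blast
    moreover have "x' \<in> good (Suc i) N' q'" by (rule l) (simp add: x'_def tail_add_def m'_def)
    moreover have "\<exists>h\<in>W i. f x' = act h (f x)" unfolding x'_def
      by (rule R_step[OF x(1,2)]) (use x(3) k' in \<open>auto simp: m'_def\<close>)
    moreover have "\<forall>z. (\<forall>n<m'. z n = x n) \<longrightarrow> z \<notin> F i" using l' by (auto simp: m'_def)
    ultimately show "\<exists>\<sigma>'. (case \<sigma>' of (x, k, N, q, m) \<Rightarrow> x \<in> R \<and> x \<in> good (Suc i) N q \<and> (\<forall>a\<ge>k. g a - g k \<in> V q)) \<and>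
       (case (\<sigma>, \<sigma>') of ((x, k, N, q, m), (x', k', N', q', m')) \<Rightarrow>
        m < m' \<and> k < k' \<and> x' = tail_add m' (g k' - g k) x \<and> (\<exists>h\<in>W i. f x' = act h (f x)) \<and>
        (\<forall>z. (\<forall>n<m'. z n = x n) \<longrightarrow> z \<notin> F i))"
      using k' by (intro exI[of _ "(x', k', N', q', m')"]) (auto simp: \<sigma> m'_def x'_def)
  qed
  then obtain \<sigma> :: "nat \<Rightarrow> (nat \<Rightarrow> 'g) \<times> nat \<times> nat \<times> nat \<times> nat" where \<sigma>: "\<And>i.
     (case \<sigma> i of (x, k, N, q, m) \<Rightarrow> x \<in> R \<and> x \<in> good i N q \<and> (\<forall>a\<ge>k. g a - g k \<in> V q)) \<and>
     (case (\<sigma> i, \<sigma> (Suc i)) of ((x, k, N, q, m), (x', k', N', q', m')) \<Rightarrow>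
        m < m' \<and> k < k' \<and> x' = tail_add m' (g k' - g k) x \<and> (\<exists>h\<in>W i. f x' = act h (f x)) \<and>
        (\<forall>z. (\<forall>n<m'. z n = x n) \<longrightarrow> z \<notin> F i))"
    by blast
  define x where "x i = fst (\<sigma> i)" for i
  define k where "k i = fst (snd (\<sigma> i))" for i
  define m where "m i = snd (snd (snd (snd (\<sigma> i))))" for i
  have xR: "x i \<in> R" for i
    using \<sigma>[of i] unfolding x_def by (auto simp: case_prod_beta)
  have move: "m i < m (Suc i)" "k i < k (Suc i)" "x (Suc i) = tail_add (m (Suc i)) (g (k (Suc i)) - g (k i)) (x i)"
      "\<exists>h\<in>W i. f (x (Suc i)) = act h (f (x i))" "\<And>z. (\<And>n. n < m (Suc i) \<Longrightarrow> z n = x i n) \<Longrightarrow> z \<notin> F i" for i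
    using \<sigma>[of i] unfolding x_def k_def m_def by (auto simp: case_prod_beta)
  have m_mono: "strict_mono m" and k_mono: "strict_mono k" using move by (auto simp: strict_mono_Suc_iff)
  have agree: "x j n = x i n" if "i \<le> j" "n < m (Suc i)" for i j n
    using that
  proof (induction rule: dec_induct)
    case (step j)
    have "m (Suc i) \<le> m (Suc j)" using strict_mono_leD[OF m_mono] step by simp
    then have "x (Suc j) n = x j n" using move(3)[of j] step.prems
      by (simp add: tail_add_def)
    then show ?case using step by simp
  qed simp
  \<comment> \<open>Coordinate \<open>n\<close> no longer changes after stage \<open>n\<close>,
    because later translations start beyond it.\<close>
  define y where "y n = x n n" for n
  have below: "n < m (Suc n)" for n using strict_mono_imp_increasing[OF m_mono, of "Suc n"] by simp
  have y: "y n = x i n" if "n < m (Suc i)" for n i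
    using agree[of i n n] agree[of n i n] that below by (cases "i \<le> n") (auto simp: y_def)
  have "y \<notin> F i" for i by (rule move(5)) (rule y)
  then have yF: "y \<in> - (\<Union>n. F n)" by blast
  have "x \<longlonglongrightarrow> y"
  proof (rule topological_tendstoI)
    fix U assume "open U" "y \<in> U"
    then obtain l where l: "\<And>z. (\<And>i. i < l \<Longrightarrow> z i = y i) \<Longrightarrow> z \<in> U"
      using open_fun_finitely_determined by metis
    show "eventually (\<lambda>i. x i \<in> U) sequentially"
    proof (rule eventually_sequentiallyI)
      fix i assume "l \<le> i"
      then show "x i \<in> U" using below[of i] by (intro l y[symmetric]) auto
    qed
  qed
  then have fy: "(\<lambda>i. f (x i)) \<longlonglongrightarrow> f y"
    using R_F xR yF by (intro continuous_on_tendsto_compose[OF f_cont]) auto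
  obtain h where h: "\<And>i. h i \<in> W i" "\<And>i. f (x (Suc i)) = act (h i) (f (x i))" using move(4) by metis
  \<comment> \<open>Accumulates the moves on the left, so that consecutive terms satisfy
    \<open>a (Suc i) - a i = h i\<close>.\<close>
  define a where "a = rec_nat 0 (\<lambda>i b. h i + b)"
  have a: "a 0 = 0" "a (Suc i) = h i + a i" for i by (auto simp: a_def)
  have "convergent a" by (rule W(3)) (simp add: a h)
  then obtain \<alpha> where "a \<longlonglongrightarrow> \<alpha>" by (auto simp: convergent_def)
  then have "(\<lambda>i. (a i, f (x 0))) \<longlonglongrightarrow> (\<alpha>, f (x 0))" by (intro tendsto_intros)
  then have "(\<lambda>i. (\<lambda>(h, y). act h y) (a i, f (x 0))) \<longlonglongrightarrow> (\<lambda>(h, y). act h y) (\<alpha>, f (x 0))"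
    using assms(3) unfolding continuous_action_def
    by (intro continuous_on_tendsto_compose[of UNIV "\<lambda>(h, y). act h y"]) auto
  moreover have "f (x i) = act (a i) (f (x 0))" for i
  proof (induction i)
    case 0
    then show ?case using assms(3) by (simp add: a continuous_action_def)
  next
    case (Suc i)
    then show ?case using assms(3) unfolding h(2) a continuous_action_def by metis
  qed
  then have "(\<lambda>i. f (x i)) = (\<lambda>i. act (a i) (f (x 0)))" by (rule ext)
  ultimately have "(\<lambda>i. f (x i)) \<longlonglongrightarrow> act \<alpha> (f (x 0))" by (simp only: prod.case)
  then have "f y = act \<alpha> (f (x 0))" using fy LIMSEQ_unique by blast
  then have "E_group (x 0) y" using f(2) by (auto simp: orbit_rel_def)
  then obtain L where "(\<lambda>n. x 0 n - y n) \<longlonglongrightarrow> L" by (auto simp: E_group_def convergent_def)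
  then have "(\<lambda>i. x 0 (m i) - y (m i)) \<longlonglongrightarrow> L"
    using LIMSEQ_subseq_LIMSEQ[OF _ m_mono] by (auto simp: o_def)
  then have "(\<lambda>i. - (x 0 (m i) - y (m i)) + g (k 0)) \<longlonglongrightarrow> - L + g (k 0)" by (intro tendsto_intros)
  \<comment> \<open>The translations telescope at coordinates past all their starting places. At
    \<open>n = m i\<close> the limit already agrees with \<open>x i\<close>, so convergence of
    \<open>x 0 - y\<close> forces convergence of \<open>g\<close> along \<open>k\<close>.\<close>
  moreover have "x i n = g (k i) - g (k 0) + x 0 n" if "m i \<le> n" for i n
    using that
  proof (induction i)
    case (Suc i)
    then have "m i \<le> n" using move(1)[of i] by simp
    then show ?case using Suc move(3)[of i] by (simp add: tail_add_def add_diff_eq flip: add.assoc)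
  qed simp
  then have "y (m i) = g (k i) - g (k 0) + x 0 (m i)" for i
    using y[of "m i" i] move(1)[of i] by simp
  then have "(\<lambda>i. - (x 0 (m i) - y (m i)) + g (k 0)) = g \<circ> k" by (simp add: fun_eq_iff)
  ultimately have "(g \<circ> k) \<longlonglongrightarrow> - L + g (k 0)" by simp
  then have "g \<longlonglongrightarrow> - L + g (k 0)" using right_Cauchy_tendsto_subseq[OF g(2) k_mono] by blast
  then show False using g(1) by (auto simp: convergent_def)
qed

end
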